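(* Let $M$ be a finite abelian group of exponent greater than $2$ and even order, written as $M=C_{2i_1}\times\cdots\times C_{2i_s}\times M_1$ with $M_1$ of odd order, $s\geq1$, $i_j\geq 1$. Then $\mathrm{Aut}(L_M)\cong\mathcal{A}\ltimes_\sigma\mathcal{B}$ and $\mathrm{Half}(L_M)\cong C_2\times(\mathcal{A}\ltimes_\sigma\mathcal{B})$, where $\mathcal{A}\cong S_3\times\mathrm{Aut}(M)$, $\mathcal{B}\cong C_2^{2s}$, and $\sigma:\mathcal{A}\to\mathrm{Aut}(\mathcal{B})$ is the conjugation action $\sigma_\alpha(\beta)=\alpha\beta\alpha^{-1}$ inside $\mathrm{Aut}(L_M)$.
   Context: $C_n$ denotes the cyclic group of order $n$ and $S_3$ the symmetric group on three letters. Let $K=\{1,a,b,c\}$ be the Klein four-group. Set $L_M=K\times M$ with the operation $(A,x)*(B,y)=(AB,xy)$ if $B=1$, and $(A,x)*(B,y)=(AB,x^{-1}y)$ if $B\neq 1$. For $u,v\in M$ with $u^2=v^2=1$, $\alpha_{(u,v)}:K\to M$ is defined by $\alpha_{(u,v)}(1)=1$, $\alpha_{(u,v)}(a)=u$, $\alpha_{(u,v)}(b)=v$, $\alpha_{(u,v)}(c)=uv$. For $f'\in\mathrm{Aut}(K)$, $f''\in\mathrm{Aut}(M)$ define $F^+_{(f',f'',u,v)}(A,x)=(f'(A),f''(x)\alpha_{(u,v)}(A))$. Let $H=\{x\in M:x^2=1\}$, $\mathcal{A}=\{F^+_{(f',f'',1,1)}: f'\in\mathrm{Aut}(K), f''\in\mathrm{Aut}(M)\}$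 and $\mathcal{B}=\{F^+_{(I_K,I_M,x,y)}: x,y\in H\}$, where $I_K,I_M$ are identity maps; both are subgroups of $\mathrm{Aut}(L_M)$. $\mathrm{Half}(L_M)$ is the group of half-automorphisms of $L_M$, i.e. bijections $f$ with $f(XY)\in\{f(X)f(Y),f(Y)f(X)\}$ for all $X,Y$. *)

theory Defs
  imports "HOL-Algebra.Algebra"
begin

datatype klein = K1 | Ka | Kb | Kc

fun kmul :: "klein \<Rightarrow> klein \<Rightarrow> klein" where
  "kmul K1 y = y"
| "kmul x K1 = x"
| "kmul Ka Ka = K1" | "kmul Ka Kb = Kc" | "kmul Ka Kc = Kb"
| "kmul Kb Ka = Kc" | "kmul Kb Kb = K1" | "kmul Kb Kc = Ka"
| "kmul Kc Ka = Kb" | "kmul Kc Kb = Ka" | "kmul Kc Kc = K1"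

definition klein_group :: "klein monoid" where
  "klein_group = \<lparr>carrier = UNIV, monoid.mult = kmul, one = K1\<rparr>"

definition loopL :: "('a, 'c) monoid_scheme \<Rightarrow> (klein \<times> 'a) monoid" where
  "loopL M = \<lparr>carrier = UNIV \<times> carrier M,
     monoid.mult = (\<lambda>(A, x) (B, y). if B = K1 then (kmul A B, x \<otimes>\<^bsub>M\<^esub> y)
                             else (kmul A B, inv\<^bsub>M\<^esub> x \<otimes>\<^bsub>M\<^esub> y)),
     one = (K1, \<one>\<^bsub>M\<^esub>)\<rparr>"

definition alphaK :: "('a, 'c) monoid_scheme \<Rightarrow> 'a \<Rightarrow> 'a \<Rightarrow> klein \<Rightarrow> 'a" where
  "alphaK M u v A = (case A of K1 \<Rightarrow> \<one>\<^bsub>M\<^esub> | Ka \<Rightarrow> u | Kb \<Rightarrow> v | Kc \<Rightarrow> u \<otimes>\<^bsub>M\<^esub> v)"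

text \<open>F^+_(f',f'',u,v), as a map on the carrier of L_M (extensional, as in BijGroup).\<close>
definition Fplus :: "('a, 'c) monoid_scheme \<Rightarrow> (klein \<Rightarrow> klein) \<Rightarrow> ('a \<Rightarrow> 'a) \<Rightarrow> 'a \<Rightarrow> 'a
                     \<Rightarrow> (klein \<times> 'a \<Rightarrow> klein \<times> 'a)" where
  "Fplus M f' f'' u v = (\<lambda>(A, x) \<in> carrier (loopL M). (f' A, f'' x \<otimes>\<^bsub>M\<^esub> alphaK M u v A))"

definition Hinv :: "('a, 'c) monoid_scheme \<Rightarrow> 'a set" where
  "Hinv M = {x \<in> carrier M. x \<otimes>\<^bsub>M\<^esub> x = \<one>\<^bsub>M\<^esub>}"

definition calA :: "('a, 'c) monoid_scheme \<Rightarrow> (klein \<times> 'a \<Rightarrow> klein \<times> 'a) set" where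
  "calA M = {Fplus M f' f'' \<one>\<^bsub>M\<^esub> \<one>\<^bsub>M\<^esub> | f' f''. f' \<in> auto klein_group \<and> f'' \<in> auto M}"

definition calB :: "('a, 'c) monoid_scheme \<Rightarrow> (klein \<times> 'a \<Rightarrow> klein \<times> 'a) set" where
  "calB M = {Fplus M id id x y | x y. x \<in> Hinv M \<and> y \<in> Hinv M}"

definition halfauto :: "('a, 'c) monoid_scheme \<Rightarrow> ('a \<Rightarrow> 'a) set" where
  "halfauto L = {f. f \<in> Bij (carrier L) \<and> (\<forall>p\<in>carrier L. \<forall>q\<in>carrier L.
       f (p \<otimes>\<^bsub>L\<^esub> q) = f p \<otimes>\<^bsub>L\<^esub> f q \<or> f (p \<otimes>\<^bsub>L\<^esub> q) = f q \<otimes>\<^bsub>L\<^esub> f p)}"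

definition HalfGroup :: "('a, 'c) monoid_scheme \<Rightarrow> ('a \<Rightarrow> 'a) monoid" where
  "HalfGroup L = BijGroup (carrier L) \<lparr>carrier := halfauto L\<rparr>"

text \<open>A \<ltimes>_\<sigma> B with \<sigma> : A \<rightarrow> Aut(B); the pair (a,b) stands for b\<cdot>a, so
  (a,b)(a',b') = (a a', b \<sigma>_a(b')).\<close>
definition semidirect_product ::
  "('a, 'c) monoid_scheme \<Rightarrow> ('b, 'd) monoid_scheme \<Rightarrow> ('a \<Rightarrow> 'b \<Rightarrow> 'b) \<Rightarrow> ('a \<times> 'b) monoid" where
  "semidirect_product A B \<sigma> = \<lparr>carrier = carrier A \<times> carrier B,
     monoid.mult = (\<lambda>(a, b) (a', b'). (a \<otimes>\<^bsub>A\<^esub> a', b \<otimes>\<^bsub>B\<^esub> \<sigma> a b')),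
     one = (\<one>\<^bsub>A\<^esub>, \<one>\<^bsub>B\<^esub>)\<rparr>"

definition group_exponent :: "('a, 'c) monoid_scheme \<Rightarrow> nat" where
  "group_exponent G = (LEAST n::nat. 0 < n \<and> (\<forall>x\<in>carrier G. x [^]\<^bsub>G\<^esub> n = \<one>\<^bsub>G\<^esub>))"

end

theory Submission
  imports Defs
begin

text \<open>
  Every \<open>(A, x)\<close> with \<open>A \<noteq> 1\<close> squares to the identity, so a half-automorphism \<open>\<phi>\<close> maps the elements
  \<open>(1, x)\<close> with \<open>x\<^sup>2 \<noteq> 1\<close> among themselves; these generate \<open>1 \<times> M\<close> because the exponent of \<open>M\<close>
  exceeds 2. Hence \<open>\<phi>(1, x) = (1, g x)\<close> with \<open>g \<in> Aut(M)\<close>, and comparing \<open>\<phi>(A, y x)\<close> with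
  \<open>\<phi>(A, y)\<close> gives \<open>\<phi>(A, x) = (f A, \<theta> A \<cdot> (g x)\<^sup>\<plusminus>\<^sup>1)\<close> with a sign that depends only on \<open>A\<close>.
  The products of two elements with distinct nontrivial \<open>K\<close>-components force these signs to agree
  and \<open>\<theta> : K \<rightarrow> M\<close> to be a homomorphism. The common sign \<open>+\<close> gives the maps \<open>F\<^sup>+\<close>; the sign \<open>-\<close>
  gives their products with the central involution that inverts \<open>x\<close> exactly when \<open>A \<noteq> 1\<close>, which is
  a half-automorphism but not an automorphism and accounts for the factor \<open>C\<^sub>2\<close>.
\<close>

section \<open>Semidirect products and central involutions\<close>

text \<open>The semidirect product is never shown to be a group on its own, so isomorphism has to be
  reversed for a source that is merely closed under multiplication. Closure is what lets
  \<open>inv_into\<close> undo \<open>h\<close> on a product.\<close>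

lemma iso_imp_iso_sym_closed:
  assumes h: "h \<in> iso G H"
    and closed: "\<And>x y. \<lbrakk>x \<in> carrier G; y \<in> carrier G\<rbrakk> \<Longrightarrow> x \<otimes>\<^bsub>G\<^esub> y \<in> carrier G"
  shows "H \<cong> G"
proof -
  have bij: "bij_betw h (carrier G) (carrier H)" and hom: "h \<in> hom G H"
    using h by (auto simp: iso_def)
  let ?k = "inv_into (carrier G) h"
  have bij': "bij_betw ?k (carrier H) (carrier G)"
    using bij by (rule bij_betw_inv_into)
  have "?k (x \<otimes>\<^bsub>H\<^esub> y) = ?k x \<otimes>\<^bsub>G\<^esub> ?k y" if "x \<in> carrier H" "y \<in> carrier H" for x y
  proof -
    have k: "?k x \<in> carrier G" "?k y \<in> carrier G" "h (?k x) = x" "h (?k y) = y"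
      using that bij bij' by (auto simp: bij_betw_inv_into_right bij_betwE)
    then have "h (?k x \<otimes>\<^bsub>G\<^esub> ?k y) = x \<otimes>\<^bsub>H\<^esub> y"
      using hom by (simp add: hom_mult)
    then show ?thesis
      using bij closed[OF k(1,2)] by (metis bij_betw_inv_into_left)
  qed
  then have "?k \<in> iso H G"
    using bij' by (auto simp: iso_def hom_def bij_betwE)
  then show ?thesis
    by (rule is_isoI)
qed

text \<open>The map taking (a, b) to b a is multiplicative because b (a b' a^-1) (a a') = (b a) (b'
  a'). It is injective by \<open>AB\<close> and surjective by \<open>gen\<close>, while
  \<open>norm\<close> keeps the second components in \<open>B\<close>.\<close>

lemma (in group) iso_semidirect_product:
  assumes A: "subgroup A G" and B: "subgroup B G"
    and AB: "A \<inter> B = {\<one>}"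
    and gen: "\<And>g. g \<in> carrier G \<Longrightarrow> \<exists>a\<in>A. \<exists>b\<in>B. g = b \<otimes> a"
    and norm: "\<And>a b. \<lbrakk>a \<in> A; b \<in> B\<rbrakk> \<Longrightarrow> a \<otimes> b \<otimes> inv a \<in> B"
  shows "G \<cong> semidirect_product (G\<lparr>carrier := A\<rparr>) (G\<lparr>carrier := B\<rparr>) (\<lambda>a b. a \<otimes> b \<otimes> inv a)"
    (is "G \<cong> ?S")
proof (rule iso_imp_iso_sym_closed)
  note Ain = subgroup.mem_carrier[OF A] and Bin = subgroup.mem_carrier[OF B]
  let ?h = "\<lambda>(a, b). b \<otimes> a"
  have "?h \<in> hom ?S G"
  proof (rule homI)
    show "?h p \<in> carrier G" if "p \<in> carrier ?S" for p
      using that Ain Bin by (auto simp: semidirect_product_def)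
    fix p q
    assume "p \<in> carrier ?S" "q \<in> carrier ?S"
    then obtain a b a' b' where pq: "p = (a, b)" "q = (a', b')"
      and mem: "a \<in> A" "b \<in> B" "a' \<in> A" "b' \<in> B"
      by (auto simp: semidirect_product_def)
    note car = mem(1,3)[THEN Ain] mem(2,4)[THEN Bin]
    have "inv a \<otimes> (a \<otimes> a') = a'"
      using car by (simp flip: m_assoc)
    then have "b \<otimes> (a \<otimes> b' \<otimes> inv a) \<otimes> (a \<otimes> a') = b \<otimes> a \<otimes> (b' \<otimes> a')"
      using car by (simp add: m_assoc)
    then show "?h (p \<otimes>\<^bsub>?S\<^esub> q) = ?h p \<otimes> ?h q"
      by (simp add: pq semidirect_product_def)
  qed
  moreover have "inj_on ?h (carrier ?S)"
  proof (rule inj_onI)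
    fix p q
    assume "p \<in> carrier ?S" "q \<in> carrier ?S" and eq: "?h p = ?h q"
    then obtain a b a' b' where pq: "p = (a, b)" "q = (a', b')"
      and mem: "a \<in> A" "b \<in> B" "a' \<in> A" "b' \<in> B"
      by (auto simp: semidirect_product_def)
    note car = mem(1,3)[THEN Ain] mem(2,4)[THEN Bin]
    have e: "b \<otimes> a = b' \<otimes> a'"
      using eq pq by simp
    \<comment> \<open>From b a = b' a' the quotient b'^-1 b in \<open>B\<close> equals a' a^-1 in
      \<open>A\<close>, so the common value lies in the trivial intersection.\<close>
    have "inv b' \<otimes> b = inv b' \<otimes> (b \<otimes> a) \<otimes> inv a"
      using car by (simp add: m_assoc)
    also have "\<dots> = inv b' \<otimes> b' \<otimes> a' \<otimes> inv a"
      unfolding e using car by (simp only: m_assoc m_closed inv_closed)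
    finally have f: "inv b' \<otimes> b = a' \<otimes> inv a"
      using car by simp
    have "a' \<otimes> inv a \<in> A"
      using A mem by (simp add: subgroup.m_closed subgroup.m_inv_closed)
    moreover have "inv b' \<otimes> b \<in> B"
      using B mem by (simp add: subgroup.m_closed subgroup.m_inv_closed)
    ultimately have "a' \<otimes> inv a = \<one>"
      using AB f by auto
    then have "a' = a"
      using car by (metis inv_closed inv_equality inv_inv)
    then show "p = q"
      using e car pq by simp
  qed
  moreover have "?h ` carrier ?S = carrier G"
  proof
    show "?h ` carrier ?S \<subseteq> carrier G"
      using Ain Bin by (auto simp: semidirect_product_def)
    show "carrier G \<subseteq> ?h ` carrier ?S"
    proof
      fix g
      assume "g \<in> carrier G"
      then obtain a b where "a \<in> A" "b \<in> B" "g = b \<otimes> a"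
        using gen by blast
      then show "g \<in> ?h ` carrier ?S"
        by (intro image_eqI[of _ _ "(a, b)"]) (auto simp: semidirect_product_def)
    qed
  qed
  ultimately show "?h \<in> iso ?S G"
    by (simp add: iso_def bij_betw_def)
  show "p \<otimes>\<^bsub>?S\<^esub> q \<in> carrier ?S" if "p \<in> carrier ?S" "q \<in> carrier ?S" for p q
    using that A B norm by (auto simp: semidirect_product_def subgroup.m_closed)
qed

text \<open>Since \<open>z\<close> is an involution commuting with \<open>A\<close>, exponents of
  \<open>z\<close> add modulo 2, as in \<open>integer_mod_group 2\<close>. That \<open>z\<close>
  lies outside \<open>A\<close> keeps the cosets A and zA disjoint, which gives injectivity.\<close>

lemma (in group) iso_C2_DirProd:
  assumes A: "subgroup A G" and z: "z \<in> carrier G" "z \<otimes> z = \<one>" "z \<notin> A"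
    and comm: "\<And>a. a \<in> A \<Longrightarrow> z \<otimes> a = a \<otimes> z"
  shows "(\<lambda>(n, a). if n = 0 then a else z \<otimes> a)
           \<in> iso (integer_mod_group 2 \<times>\<times> (G\<lparr>carrier := A\<rparr>)) (G\<lparr>carrier := A \<union> (\<lambda>a. z \<otimes> a) ` A\<rparr>)"
    (is "?h \<in> iso ?P ?Q")
proof -
  note Ain = subgroup.mem_carrier[OF A]
  have carP: "carrier ?P = {0, 1} \<times> A"
    by (auto simp: carrier_integer_mod_group)
  have zz: "z \<otimes> (z \<otimes> a) = a" if "a \<in> carrier G" for a
    using z that by (metis l_one m_assoc)
  have "?h \<in> hom ?P ?Q"
  proof (rule homI)
    show "?h p \<in> carrier ?Q" if "p \<in> carrier ?P" for p
      using that unfolding carP by auto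
    fix p q
    assume "p \<in> carrier ?P" "q \<in> carrier ?P"
    then obtain m a n b where pq: "p = (m, a)" "q = (n, b)" and m: "m = 0 \<or> m = 1"
      and n: "n = 0 \<or> n = 1" and ab: "a \<in> A" "b \<in> A"
      unfolding carP by auto
    note car = ab[THEN Ain]
    have az: "a \<otimes> (z \<otimes> b) = z \<otimes> (a \<otimes> b)"
      using comm[OF ab(1)] car z(1) by (metis m_assoc)
    show "?h (p \<otimes>\<^bsub>?P\<^esub> q) = ?h p \<otimes>\<^bsub>?Q\<^esub> ?h q"
      using m n car z(1) by (auto simp: pq az zz m_assoc)
  qed
  moreover have "inj_on ?h (carrier ?P)"
  proof -
    have ne: "z \<otimes> a \<notin> A" if a: "a \<in> A" for a
    proof
      assume "z \<otimes> a \<in> A"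
      then have "z \<otimes> a \<otimes> inv a \<in> A"
        using A a by (simp add: subgroup.m_closed subgroup.m_inv_closed)
      then show False
        using z a Ain by (simp add: m_assoc)
    qed
    then have "b \<noteq> z \<otimes> a" if "a \<in> A" "b \<in> A" for a b
      using that by metis
    with ne show ?thesis
      unfolding carP inj_on_def using Ain z(1) by auto
  qed
  moreover have "?h ` carrier ?P = carrier ?Q"
    unfolding carP by (force simp: image_iff)
  ultimately show ?thesis
    by (simp add: iso_def bij_betw_def)
qed

text \<open>Only closure is assumed because L_M is not associative in general, so facts about
  automorphisms of groups do not cover it.\<close>

lemma subgroup_auto_closed:
  assumes closed: "\<And>x y. \<lbrakk>x \<in> carrier G; y \<in> carrier G\<rbrakk> \<Longrightarrow> x \<otimes>\<^bsub>G\<^esub> y \<in> carrier G"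
  shows "subgroup (auto G) (BijGroup (carrier G))"
proof
  show "auto G \<subseteq> carrier (BijGroup (carrier G))"
    by (auto simp: auto_def BijGroup_def)
  show "\<one>\<^bsub>BijGroup (carrier G)\<^esub> \<in> auto G"
    using id_Bij[of "carrier G"] by (auto simp: auto_def BijGroup_def hom_def closed)
  fix x
  assume x: "x \<in> auto G"
  then have xB: "x \<in> Bij (carrier G)" and xhom: "x \<in> hom G G"
    by (auto simp: auto_def)
  show "inv\<^bsub>BijGroup (carrier G)\<^esub> x \<in> auto G"
  proof -
    have "inv_into (carrier G) x (u \<otimes>\<^bsub>G\<^esub> v) = inv_into (carrier G) x u \<otimes>\<^bsub>G\<^esub> inv_into (carrier G) x v"
      if "u \<in> carrier G" "v \<in> carrier G" for u v
      by (rule Bij_inv_into_lemma[where g = "monoid.mult G", OF _ xB _ that])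
        (use xhom closed in \<open>auto simp: hom_def\<close>)
    then show ?thesis
      using restrict_inv_into_Bij[OF xB] Bij_inv_into_mem[OF xB]
      by (auto simp: inv_BijGroup[OF xB] auto_def hom_def closed)
  qed
  fix y
  assume "y \<in> auto G"
  then have yB: "y \<in> Bij (carrier G)" and yhom: "y \<in> hom G G"
    by (auto simp: auto_def)
  have "compose (carrier G) x y \<in> hom G G"
    using xhom yhom by (auto simp: hom_def compose_def closed Pi_iff)
  then show "x \<otimes>\<^bsub>BijGroup (carrier G)\<^esub> y \<in> auto G"
    using xB yB by (simp add: BijGroup_def auto_def compose_Bij)
qed

lemma mult_AutoGroup:
  assumes "f \<in> auto G" "g \<in> auto G"
  shows "f \<otimes>\<^bsub>AutoGroup G\<^esub> g = compose (carrier G) f g"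
  using assms by (simp add: AutoGroup_def BijGroup_def auto_def)

lemma carrier_AutoGroup: "carrier (AutoGroup G) = auto G"
  by (simp add: AutoGroup_def)

section \<open>The Klein four-group\<close>

lemma UNIV_klein: "(UNIV :: klein set) = {K1, Ka, Kb, Kc}"
  by (auto intro: klein.exhaust)

lemma finite_klein: "finite (UNIV :: klein set)"
  by (simp add: UNIV_klein)

lemma kmul_K1_right [simp]: "kmul A K1 = A"
  by (cases A) simp_all

lemma kmul_self [simp]: "kmul A A = K1"
  by (cases A) simp_all

lemma kmul_comm: "kmul A B = kmul B A"
  by (cases A; cases B) simp_all

lemma kmul_assoc: "kmul (kmul A B) C = kmul A (kmul B C)"
  by (cases A; cases B; cases C) simp_all

lemma kmul_eq_K1_iff: "kmul A B = K1 \<longleftrightarrow> A = B"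
  by (cases A; cases B) simp_all

lemma kmul_left_self [simp]: "kmul A (kmul A B) = B"
  by (cases A; cases B) simp_all

lemma klein_group_simps [simp]:
  "carrier klein_group = UNIV" "x \<otimes>\<^bsub>klein_group\<^esub> y = kmul x y" "\<one>\<^bsub>klein_group\<^esub> = K1"
  by (simp_all add: klein_group_def)

lemma group_klein: "group klein_group"
  by (rule groupI) (auto simp: kmul_assoc intro: kmul_self)

lemma kmul_other:
  assumes "A \<noteq> K1" "B \<noteq> K1" "C \<noteq> K1" "A \<noteq> B" "A \<noteq> C" "B \<noteq> C"
  shows "kmul A B = C"
  using assms by (cases A; cases B; cases C) simp_all

text \<open>The product of two distinct nontrivial elements of K is the third one, so the
  multiplication table is invariant under every permutation of a, b, c.\<close>

lemma auto_klein_iff: "f \<in> auto klein_group \<longleftrightarrow> bij f \<and> f K1 = K1"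
proof
  assume f: "f \<in> auto klein_group"
  then have "\<forall>A B. f (kmul A B) = kmul (f A) (f B)"
    by (simp add: auto_def hom_def)
  then have "f (kmul K1 K1) = kmul (f K1) (f K1)"
    by blast
  then have "f K1 = K1"
    by simp
  then show "bij f \<and> f K1 = K1"
    using f by (auto simp: auto_def Bij_def)
next
  assume f: "bij f \<and> f K1 = K1"
  then have inj: "f A = f B \<longleftrightarrow> A = B" for A B
    by (auto simp: bij_def inj_def)
  have "f (kmul A B) = kmul (f A) (f B)" for A B
  proof (cases "A = K1 \<or> B = K1 \<or> A = B")
    case True
    then show ?thesis using f by auto
  next
    case False
    then have "kmul A B \<noteq> K1" "kmul A B \<noteq> A" "kmul A B \<noteq> B"
      by (cases A; cases B; simp)+
    then show ?thesis
      using False f kmul_other[of "f A" "f B" "f (kmul A B)"] by (metis inj)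
  qed
  then show "f \<in> auto klein_group"
    using f by (simp add: auto_def Bij_def hom_def)
qed

text \<open>The nontrivial elements receive the numbers 1, 2, 3 on which \<open>sym_group 3\<close>
  acts; \<open>K1\<close> receives 0, which every permutation of {1..3} fixes.\<close>

fun klein_nat :: "klein \<Rightarrow> nat" where
  "klein_nat K1 = 0" | "klein_nat Ka = 1" | "klein_nat Kb = 2" | "klein_nat Kc = 3"

lemma bij_betw_klein_nat: "bij_betw klein_nat UNIV {..3}"
  by (auto simp: bij_betw_def UNIV_klein atMost_nat_numeral)

text \<open>Conjugation by the numbering \<open>klein_nat\<close> turns a permutation of {1..3} into
  a bijection of K fixing \<open>K1\<close>, and by \<open>auto_klein_iff\<close> these bijections
  are exactly the automorphisms.\<close>

lemma auto_klein_iso_sym_group: "sym_group 3 \<cong> AutoGroup klein_group"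
proof -
  define d where "d = inv_into UNIV klein_nat"
  have inj: "klein_nat A = klein_nat B \<longleftrightarrow> A = B" for A B
    using bij_betw_klein_nat by (auto simp: bij_betw_def inj_def)
  have le3: "klein_nat A \<le> 3" for A
    by (cases A) simp_all
  have dk [simp]: "d (klein_nat A) = A" for A
    using bij_betw_klein_nat unfolding d_def by (meson UNIV_I bij_betw_inv_into_left)
  have kd: "klein_nat (d n) = n" if "n \<le> 3" for n
    using bij_betw_klein_nat that unfolding d_def by (simp add: bij_betw_inv_into_right)
  have d0: "d 0 = K1"
    using dk[of K1] by simp
  have k0: "klein_nat A = 0 \<longleftrightarrow> A = K1" for A
    by (cases A) simp_all
  let ?h = "\<lambda>p A. d (p (klein_nat A))"
  have le: "p n \<le> 3" if "p permutes {1..3}" "n \<le> 3" for p n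
    using permutes_in_image[OF that(1), of n] permutes_not_in[OF that(1), of n] that(2) by fastforce
  have p0: "p 0 = 0" if "p permutes {1..3}" for p :: "nat \<Rightarrow> nat"
    using permutes_not_in[OF that, of 0] by simp
  have h_auto: "?h p \<in> auto klein_group" if p: "p permutes {1..3}" for p
  proof -
    have "inj (?h p)"
    proof (rule injI)
      fix A B
      assume "?h p A = ?h p B"
      then have "p (klein_nat A) = p (klein_nat B)"
        using le[OF p] le3 kd by metis
      then show "A = B"
        using permutes_inj[OF p] by (simp add: inj inj_eq)
    qed
    then show ?thesis
      using finite_klein p0[OF p] d0 by (simp add: auto_klein_iff bij_def finite_UNIV_inj_surj)
  qed
  have "?h \<in> hom (sym_group 3) (AutoGroup klein_group)"
    by (rule homI) (auto simp: carrier_AutoGroup sym_group_def h_auto mult_AutoGroup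
        compose_def fun_eq_iff kd le le3)
  moreover have "inj_on ?h (carrier (sym_group 3))"
  proof (rule inj_onI)
    fix p q
    assume "p \<in> carrier (sym_group 3)" "q \<in> carrier (sym_group 3)" and eq: "?h p = ?h q"
    then have p: "p permutes {1..3}" and q: "q permutes {1..3}"
      by (auto simp: sym_group_def)
    show "p = q"
    proof
      fix n
      show "p n = q n"
      proof (cases "n \<le> 3")
        case True
        then have "d (p n) = d (q n)"
          using fun_cong[OF eq, of "d n"] by (simp add: kd)
        then show ?thesis
          using le[OF p True] le[OF q True] kd by metis
      next
        case False
        then show ?thesis
          using p q by (simp add: permutes_not_in)
      qed
    qed
  qed
  moreover have "?h ` carrier (sym_group 3) = carrier (AutoGroup klein_group)"
  proof
    show "?h ` carrier (sym_group 3) \<subseteq> carrier (AutoGroup klein_group)"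
      by (auto simp: carrier_AutoGroup sym_group_def h_auto)
    show "carrier (AutoGroup klein_group) \<subseteq> ?h ` carrier (sym_group 3)"
    proof
      fix f
      assume "f \<in> carrier (AutoGroup klein_group)"
      then have f: "inj f" "f K1 = K1"
        by (auto simp: carrier_AutoGroup auto_klein_iff bij_def)
      have fK: "f A = K1 \<longleftrightarrow> A = K1" for A
        using f by (metis inj_eq)
      \<comment> \<open>The preimage of \<open>f\<close> under conjugation. It must be the identity
        off {1..3} to count as a permutation of that set; at 0 this agrees with
        \<open>f K1 = K1\<close>.\<close>
      define p where "p n = (if n \<in> {1..3} then klein_nat (f (d n)) else n)" for n
      have dK: "d n = K1 \<longleftrightarrow> n = 0" if "n \<le> 3" for n
        using that by (metis d0 k0 kd)
      have "p n \<in> {1..3}" if "n \<in> {1..3}" for n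
      proof -
        have "klein_nat (f (d n)) \<noteq> 0"
          using that by (auto simp: k0 fK dK)
        then show ?thesis
          using that le3[of "f (d n)"] by (auto simp: p_def)
      qed
      moreover have "inj_on p {1..3}"
        using f(1) by (intro inj_onI) (auto simp: p_def inj inj_eq dest: arg_cong[of _ _ klein_nat] simp: kd)
      ultimately have "bij_betw p {1..3} {1..3}"
        unfolding bij_betw_def by (metis endo_inj_surj finite_atLeastAtMost image_subsetI)
      then have "p permutes {1..3}"
        by (rule bij_imp_permutes) (auto simp: p_def)
      moreover have "?h p = f"
      proof
        fix A
        show "?h p A = f A"
          using le3[of A] f(2) k0[of A] by (cases "A = K1") (simp_all add: p_def d0 Suc_le_eq)
      qed
      ultimately show "f \<in> ?h ` carrier (sym_group 3)"
        by (auto simp: sym_group_def)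
    qed
  qed
  ultimately show ?thesis
    by (intro is_isoI[of ?h]) (simp add: iso_def bij_betw_def)
qed

section \<open>Classification of half-automorphisms\<close>

lemma (in comm_group) inv_eq_self_iff:
  assumes "x \<in> carrier G"
  shows "inv x = x \<longleftrightarrow> x \<otimes> x = \<one>"
  using assms by (metis inv_equality r_inv)

text \<open>The Boolean is a sign: True stands for the exponent +1, False for -1. One formula then
  serves the loop product, the half-automorphisms and \<open>flip\<close>.\<close>

definition twist :: "('a, 'c) monoid_scheme \<Rightarrow> bool \<Rightarrow> 'a \<Rightarrow> 'a" where
  "twist M e x = (if e then x else inv\<^bsub>M\<^esub> x)"

lemma twist_True [simp]: "twist M True x = x"
  by (simp add: twist_def)

lemma (in comm_group) twist_closed [simp]: "x \<in> carrier G \<Longrightarrow> twist G e x \<in> carrier G"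
  by (simp add: twist_def)

lemma (in comm_group) twist_one [simp]: "twist G e \<one> = \<one>"
  by (simp add: twist_def)

lemma (in comm_group) twist_twist: "x \<in> carrier G \<Longrightarrow> twist G e (twist G e x) = x"
  by (simp add: twist_def)

text \<open>Suppose the sign + fails at x and the sign - fails at y. The steps from 1 give q x =
  q(1) g(x)^-1 and q y = q(1) g(y). The step from y to x, by the factor y^-1 x, then forces either q
  x = q(1) g(x) or g(y)^2 = 1; the first contradicts the choice of x, the second that of y.\<close>

lemma (in comm_group) steps_imp_uniform_sign:
  assumes g: "g \<in> hom G G" and q: "\<And>x. x \<in> carrier G \<Longrightarrow> q x \<in> carrier G"
    and step: "\<And>x y. \<lbrakk>x \<in> carrier G; y \<in> carrier G\<rbrakk>
                 \<Longrightarrow> q (y \<otimes> x) = q y \<otimes> g x \<or> q (y \<otimes> x) = q y \<otimes> inv (g x)"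
  shows "\<exists>e. \<forall>x\<in>carrier G. q x = q \<one> \<otimes> twist G e (g x)"
proof (rule ccontr)
  assume "\<not> ?thesis"
  then obtain x y where x: "x \<in> carrier G" "q x \<noteq> q \<one> \<otimes> g x"
    and y: "y \<in> carrier G" "q y \<noteq> q \<one> \<otimes> inv (g y)"
    unfolding twist_def by (metis (full_types))
  interpret g: group_hom G G g
    using g by (simp add: group_hom_def group_hom_axioms_def is_group)
  have p: "q \<one> \<in> carrier G" and gx: "g x \<in> carrier G" and gy: "g y \<in> carrier G"
    using q x y by auto
  have qx: "q x = q \<one> \<otimes> inv (g x)" and qy: "q y = q \<one> \<otimes> g y"
    using step[of x \<one>] step[of y \<one>] x y by auto
  have "y \<otimes> (inv y \<otimes> x) = x"
    using x y by (simp flip: m_assoc)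
  then consider "q x = q y \<otimes> (inv (g y) \<otimes> g x)" | "q x = q y \<otimes> inv (inv (g y) \<otimes> g x)"
    using step[of "inv y \<otimes> x" y] x y by auto
  then show False
  proof cases
    case 1
    moreover have "q \<one> \<otimes> g y \<otimes> (inv (g y) \<otimes> g x) = q \<one> \<otimes> (g y \<otimes> inv (g y)) \<otimes> g x"
      using p gx gy by (simp only: m_assoc m_closed inv_closed)
    ultimately show ?thesis
      using x(2) qy p gx gy by simp
  next
    case 2
    then have "q \<one> \<otimes> inv (g x) = q \<one> \<otimes> (g y \<otimes> g y \<otimes> inv (g x))"
      using p gx gy by (simp add: qx qy inv_mult m_ac)
    then have "inv (g x) = g y \<otimes> g y \<otimes> inv (g x)"
      using p gx gy by simp
    then have "g y \<otimes> g y = \<one>"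
      using gx gy by (metis inv_closed m_closed r_cancel_one')
    then have "inv (g y) = g y"
      using gy by (simp add: inv_eq_self_iff)
    then show ?thesis
      using y(2) qy by simp
  qed
qed

text \<open>This is the relation that would arise if the signs at A and B differed: the left side
  depends on u^-1 v, the right side on u v. Taking u = v = 1 gives p = d or p = d^-1, inserting
  \<open>x\<close> in one slot forces d^2 = 1, and u = x, v = x^-1 finally yields x^2 = 1.\<close>

lemma (in comm_group) opposite_signs_impossible:
  assumes p: "p \<in> carrier G" and d: "d \<in> carrier G"
    and x: "x \<in> carrier G" "x \<otimes> x \<noteq> \<one>"
    and h: "\<And>u v. \<lbrakk>u \<in> carrier G; v \<in> carrier G\<rbrakk> \<Longrightarrow>
              p \<otimes> twist G c (inv u \<otimes> v) = d \<otimes> (u \<otimes> v)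
            \<or> p \<otimes> twist G c (inv u \<otimes> v) = inv (d \<otimes> (u \<otimes> v))"
  shows False
proof -
  have ix: "inv x \<noteq> x"
    using x by (simp add: inv_eq_self_iff)
  have pd: "p = d \<or> p = inv d"
    using h[of \<one> \<one>] p d by simp
  \<comment> \<open>The instances (1, x) and (x, 1) exchange their roles when \<open>c\<close>
    changes, so both disjunctions hold for either value of \<open>c\<close>.\<close>
  have a: "p \<otimes> x = d \<otimes> x \<or> p \<otimes> x = inv d \<otimes> inv x"
    and b: "p \<otimes> inv x = d \<otimes> x \<or> p \<otimes> inv x = inv d \<otimes> inv x"
    using h[of \<one> x] h[of x \<one>] p d x by (cases c; simp add: twist_def inv_mult)+
  have dd: "inv d = d"
    using pd
  proof
    assume "p = d"
    then show ?thesis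
      using b ix p d x by (metis inv_closed l_cancel r_cancel)
  next
    assume "p = inv d"
    then show ?thesis
      using a ix p d x by (metis inv_closed l_cancel r_cancel)
  qed
  then have "p = d"
    using pd by simp
  with dd have "d \<otimes> twist G c (inv x \<otimes> inv x) = d"
    using h[of x "inv x"] d x by simp
  then have "twist G c (inv x \<otimes> inv x) = \<one>"
    using d x by simp
  then have "inv (x \<otimes> x) = \<one>"
    using x by (cases c) (simp_all add: twist_def inv_mult)
  with x show False
    by (metis inv_inv inv_one m_closed)
qed

section \<open>Half-automorphisms of L_M in coordinates\<close>

lemma carrier_loopL [simp]: "carrier (loopL M) = UNIV \<times> carrier M"
  by (simp add: loopL_def)

lemma mult_loopL [simp]:
  "(A, x) \<otimes>\<^bsub>loopL M\<^esub> (B, y) = (kmul A B, twist M (B = K1) x \<otimes>\<^bsub>M\<^esub> y)"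
  by (simp add: loopL_def twist_def)

text \<open>\<open>ex_square\<close> is the form in which exponent greater than 2 enters;
  \<open>fin\<close> turns injective self-maps of M and of L_M into bijections.\<close>

locale loop_setup = comm_group M for M (structure) +
  assumes fin: "finite (carrier M)"
    and ex_square: "\<exists>x\<in>carrier M. x \<otimes> x \<noteq> \<one>"
begin

text \<open>The disjunct \<open>A = K1\<close> in the sign records that \<phi> acts on the copy of M
  over \<open>K1\<close> by \<open>g\<close> itself, whatever \<open>e\<close> is. \<theta> is kept
  as a homomorphism here and is turned into a pair (u, v) in \<open>halfauto_cases\<close>.\<close>

lemma halfauto_classify:
  assumes \<phi>: "\<phi> \<in> halfauto (loopL M)"
  obtains f g \<theta> e where "f \<in> auto klein_group" "g \<in> auto M" "\<theta> \<in> hom klein_group M"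
    "\<And>A x. x \<in> carrier M \<Longrightarrow> \<phi> (A, x) = (f A, twist M (e \<or> A = K1) (g x) \<otimes> \<theta> A)"
proof -
  obtain x0 where x0: "x0 \<in> carrier M" "x0 \<otimes> x0 \<noteq> \<one>"
    using ex_square by blast
  have bij: "bij_betw \<phi> (UNIV \<times> carrier M) (UNIV \<times> carrier M)"
    using \<phi> by (simp add: halfauto_def Bij_def)
  have half: "\<phi> (p \<otimes>\<^bsub>loopL M\<^esub> q) = \<phi> p \<otimes>\<^bsub>loopL M\<^esub> \<phi> q \<or> \<phi> (p \<otimes>\<^bsub>loopL M\<^esub> q) = \<phi> q \<otimes>\<^bsub>loopL M\<^esub> \<phi> p"
    if "p \<in> UNIV \<times> carrier M" "q \<in> UNIV \<times> carrier M" for p q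
    using \<phi> that unfolding halfauto_def carrier_loopL by blast
  define F where "F A x = fst (\<phi> (A, x))" for A x
  define P where "P A x = snd (\<phi> (A, x))" for A x
  have \<phi>_eq: "\<phi> (A, x) = (F A x, P A x)" for A x
    by (simp add: F_def P_def)
  have P_closed [simp]: "P A x \<in> carrier M" if "x \<in> carrier M" for A x
  proof -
    have "\<phi> (A, x) \<in> UNIV \<times> carrier M"
      using bij_betwE[OF bij] that by blast
    then show ?thesis
      by (simp add: P_def mem_Times_iff)
  qed
  have inj: "A = B \<and> x = y"
    if "F A x = F B y" "P A x = P B y" "x \<in> carrier M" "y \<in> carrier M" for A B x y
    using inj_onD[OF bij_betw_imp_inj_on[OF bij], of "(A, x)" "(B, y)"] that
    by (simp add: \<phi>_eq)
  \<comment> \<open>K is commutative, so both alternatives of the half-automorphism condition have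
    the same first component.\<close>
  have F_mult: "F (kmul A B) (twist M (B = K1) x \<otimes> y) = kmul (F A x) (F B y)"
    if "x \<in> carrier M" "y \<in> carrier M" for A B x y
    using half[of "(A, x)" "(B, y)"] that by (auto simp: \<phi>_eq kmul_comm)
  have P_mult: "P (kmul A B) (twist M (B = K1) x \<otimes> y) = twist M (F B y = K1) (P A x) \<otimes> P B y
       \<or> P (kmul A B) (twist M (B = K1) x \<otimes> y) = twist M (F A x = K1) (P B y) \<otimes> P A x"
    if "x \<in> carrier M" "y \<in> carrier M" for A B x y
    using half[of "(A, x)" "(B, y)"] that by (auto simp: \<phi>_eq)
  have F1: "F K1 \<one> = K1"
    using F_mult[of \<one> \<one> K1 K1] by simp
  have P1: "P K1 \<one> = \<one>"
    using P_mult[of \<one> \<one> K1 K1] by (simp add: F1)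
  \<comment> \<open>An image with nontrivial K-component squares to the identity, so (1, x^2) and
    (1, 1) would have the same image.\<close>
  have F_nonsquare: "F K1 x = K1" if "x \<in> carrier M" "x \<otimes> x \<noteq> \<one>" for x
  proof (rule ccontr)
    assume ne: "F K1 x \<noteq> K1"
    then have "P K1 (x \<otimes> x) = \<one>"
      using P_mult[of x x K1 K1] that by (simp add: twist_def)
    moreover have "F K1 (x \<otimes> x) = K1"
      using F_mult[of x x K1 K1] that by simp
    ultimately show False
      using inj[of K1 "x \<otimes> x" K1 \<one>] that by (simp add: F1 P1)
  qed
  have FK1: "F K1 x = K1" if x: "x \<in> carrier M" for x
  proof (cases "x \<otimes> x = \<one>")
    case True
    \<comment> \<open>An involution x is the product of x0^-1 and x0 x, both of which have
      nontrivial square.\<close>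
    have "(x0 \<otimes> x) \<otimes> (x0 \<otimes> x) = (x0 \<otimes> x0) \<otimes> (x \<otimes> x)"
      using x x0(1) by (simp add: m_ac)
    then have "F K1 (x0 \<otimes> x) = K1"
      using x x0 True by (intro F_nonsquare) auto
    moreover have "inv x0 \<otimes> inv x0 \<noteq> \<one>"
      using x0 by (metis inv_closed inv_mult_group inv_eq_1_iff m_closed)
    then have "F K1 (inv x0) = K1"
      using x0 by (intro F_nonsquare) auto
    moreover have "inv x0 \<otimes> (x0 \<otimes> x) = x"
      using x x0(1) by (simp flip: m_assoc)
    ultimately show ?thesis
      using F_mult[of "inv x0" "x0 \<otimes> x" K1 K1] x x0(1) by simp
  qed (use F_nonsquare x in auto)
  \<comment> \<open>The restriction makes \<open>g\<close> extensional, as membership in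
    \<open>auto M\<close> demands.\<close>
  define g where "g = (\<lambda>x\<in>carrier M. P K1 x)"
  define f where "f A = F A \<one>" for A
  have F_eq: "F A x = f A" if "x \<in> carrier M" for A x
    using F_mult[of \<one> x A K1] that by (simp add: FK1 f_def)
  have g_closed [simp]: "g x \<in> carrier M" if "x \<in> carrier M" for x
    using that by (simp add: g_def)
  have g_mult: "g (x \<otimes> y) = g x \<otimes> g y" if "x \<in> carrier M" "y \<in> carrier M" for x y
    using P_mult[of x y K1 K1] that by (auto simp: g_def FK1 m_comm)
  have g_hom: "g \<in> hom M M"
    by (simp add: hom_def g_mult)
  have g_inj: "inj_on g (carrier M)"
    by (rule inj_onI) (use inj[of K1 _ K1] FK1 in \<open>simp add: g_def\<close>)
  have g_surj: "g ` carrier M = carrier M"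
    using g_inj fin by (intro endo_inj_surj) auto
  have g_auto: "g \<in> auto M"
    using g_hom g_inj g_surj by (simp add: auto_def Bij_def bij_betw_def g_def)
  have fK1: "f K1 = K1"
    by (simp add: f_def F1)
  have f_mult: "f (kmul A B) = kmul (f A) (f B)" for A B
    using F_mult[of \<one> \<one> A B] by (simp add: f_def)
  have "surj f"
    unfolding surj_def
  proof
    fix B
    have "(B, \<one>) \<in> \<phi> ` (UNIV \<times> carrier M)"
      using bij by (simp add: bij_betw_def)
    then obtain A x where "x \<in> carrier M" "\<phi> (A, x) = (B, \<one>)"
      by auto
    then show "\<exists>A. B = f A"
      using F_eq by (auto simp: \<phi>_eq)
  qed
  then have f_bij: "bij f"
    using finite_klein by (simp add: bij_def finite_UNIV_surj_inj)
  then have f_auto: "f \<in> auto klein_group"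
    by (simp add: auto_klein_iff fK1)
  have f_eq_K1: "f A = K1 \<longleftrightarrow> A = K1" for A
    using f_bij fK1 by (metis bij_pointE)
  \<comment> \<open>Apply the condition to the product of (A, y) and (1, x): one order of the images
    contributes g x, the other g x or its inverse.\<close>
  have P_step: "P A (y \<otimes> x) = P A y \<otimes> g x \<or> P A (y \<otimes> x) = P A y \<otimes> inv (g x)"
    if "x \<in> carrier M" "y \<in> carrier M" for A x y
    using P_mult[of y x A K1] that by (auto simp: F_eq fK1 FK1 g_def twist_def m_comm)
  have "\<exists>e. \<forall>x\<in>carrier M. P A x = P A \<one> \<otimes> twist M e (g x)" for A
    by (rule steps_imp_uniform_sign[OF g_hom _ P_step]) auto
  then obtain \<epsilon> where \<epsilon>: "\<And>A x. x \<in> carrier M \<Longrightarrow> P A x = P A \<one> \<otimes> twist M (\<epsilon> A) (g x)"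
    by metis
  define \<theta> where "\<theta> A = P A \<one>" for A
  have \<theta>_closed [simp]: "\<theta> A \<in> carrier M" for A
    by (simp add: \<theta>_def)
  have P_eq: "P A x = \<theta> A \<otimes> twist M (\<epsilon> A) (g x)" if "x \<in> carrier M" for A x
    unfolding \<theta>_def using that by (rule \<epsilon>)
  have \<theta>K1: "\<theta> K1 = \<one>"
    by (simp add: \<theta>_def P1)
  \<comment> \<open>With u = g x and v = g y, the two orders of the images of (A, x) and (B, y) have
    second components a^-1 b and b^-1 a, which are inverse to each other.\<close>
  have rel: "\<theta> (kmul A B) \<otimes> twist M (\<epsilon> (kmul A B)) (inv u \<otimes> v)
         = (inv (\<theta> A) \<otimes> \<theta> B) \<otimes> (inv (twist M (\<epsilon> A) u) \<otimes> twist M (\<epsilon> B) v)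
     \<or> \<theta> (kmul A B) \<otimes> twist M (\<epsilon> (kmul A B)) (inv u \<otimes> v)
         = inv ((inv (\<theta> A) \<otimes> \<theta> B) \<otimes> (inv (twist M (\<epsilon> A) u) \<otimes> twist M (\<epsilon> B) v))"
    if AB: "A \<noteq> K1" "B \<noteq> K1" and uv: "u \<in> carrier M" "v \<in> carrier M" for A B u v
  proof -
    have "u \<in> g ` carrier M" "v \<in> g ` carrier M"
      using uv by (simp_all only: g_surj)
    then obtain x y where x: "x \<in> carrier M" "u = g x" and y: "y \<in> carrier M" "v = g y"
      by auto
    interpret g: group_hom M M g
      using g_hom by (simp add: group_hom_def group_hom_axioms_def is_group)
    define a where "a = \<theta> A \<otimes> twist M (\<epsilon> A) u"
    define b where "b = \<theta> B \<otimes> twist M (\<epsilon> B) v"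
    have ab: "a \<in> carrier M" "b \<in> carrier M"
      using uv by (simp_all add: a_def b_def)
    have quot: "inv a \<otimes> b = (inv (\<theta> A) \<otimes> \<theta> B) \<otimes> (inv (twist M (\<epsilon> A) u) \<otimes> twist M (\<epsilon> B) v)"
      using uv by (simp add: a_def b_def inv_mult m_ac)
    have "P A x = a" "P B y = b"
      using x y by (simp_all add: P_eq a_def b_def)
    moreover have "P (kmul A B) (inv x \<otimes> y) = \<theta> (kmul A B) \<otimes> twist M (\<epsilon> (kmul A B)) (inv u \<otimes> v)"
      using x y by (simp add: P_eq)
    moreover have "P (kmul A B) (inv x \<otimes> y) = inv (P A x) \<otimes> P B y
        \<or> P (kmul A B) (inv x \<otimes> y) = inv (P B y) \<otimes> P A x"
      using P_mult[of x y A B] AB x(1) y(1) by (simp add: twist_def F_eq f_eq_K1)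
    moreover have "inv b \<otimes> a = inv (inv a \<otimes> b)"
      using ab by (simp add: inv_mult m_comm)
    ultimately show ?thesis
      unfolding quot[symmetric] by simp
  qed
  have sign_eq: "\<epsilon> A = \<epsilon> B" if AB: "A \<noteq> K1" "B \<noteq> K1" for A B
  proof (rule ccontr)
    assume ne: "\<epsilon> A \<noteq> \<epsilon> B"
    \<comment> \<open>Replacing u and v in \<open>rel\<close> by their twists with sign
      \<open>\<epsilon> B\<close> cancels the sign at B and leaves an inversion at A. The right side
      becomes d u v or its inverse, and the left side carries the sign
      \<open>\<epsilon> (kmul A B) = \<epsilon> B\<close>.\<close>
    show False
    proof (rule opposite_signs_impossible[OF \<theta>_closed _ x0, of "inv (\<theta> A) \<otimes> \<theta> B" "kmul A B"
            "\<epsilon> (kmul A B) = \<epsilon> B"])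
      fix u v
      assume uv: "u \<in> carrier M" "v \<in> carrier M"
      show "\<theta> (kmul A B) \<otimes> twist M (\<epsilon> (kmul A B) = \<epsilon> B) (inv u \<otimes> v) = inv (\<theta> A) \<otimes> \<theta> B \<otimes> (u \<otimes> v) \<or>
            \<theta> (kmul A B) \<otimes> twist M (\<epsilon> (kmul A B) = \<epsilon> B) (inv u \<otimes> v) = inv (inv (\<theta> A) \<otimes> \<theta> B \<otimes> (u \<otimes> v))"
        using rel[OF AB, of "twist M (\<epsilon> B) u" "twist M (\<epsilon> B) v"] uv ne
        by (cases "\<epsilon> A"; cases "\<epsilon> B"; cases "\<epsilon> (kmul A B)") (simp_all add: twist_def inv_mult)
    qed simp
  qed
  \<comment> \<open>Any nontrivial element of K could be chosen. The sign at \<open>K1\<close> may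
    differ from \<open>e\<close>; over \<open>K1\<close> the values come from \<open>g\<close>
    directly.\<close>
  define e where "e = \<epsilon> Ka"
  have \<epsilon>_e: "\<epsilon> A = e" if "A \<noteq> K1" for A
    using sign_eq[of A Ka] that by (simp add: e_def)
  \<comment> \<open>With u = 1, \<open>rel\<close> says that \<theta>(AB) z is d z or its inverse
    for every z. If \<theta>(AB) were not d, then z = 1 would give \<theta>(AB) = d^-1, and z =
    \<open>x0\<close> would make \<open>x0\<close> equal to its own inverse. As A and B differ, AB
    is nontrivial and carries the sign \<open>e\<close> too.\<close>
  have \<theta>_quot: "\<theta> (kmul A B) = inv (\<theta> A) \<otimes> \<theta> B"
    if AB: "A \<noteq> K1" "B \<noteq> K1" "A \<noteq> B" for A B
  proof (rule ccontr)
    let ?d = "inv (\<theta> A) \<otimes> \<theta> B"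
    assume ne: "\<theta> (kmul A B) \<noteq> ?d"
    have C: "kmul A B \<noteq> K1"
      using AB by (simp add: kmul_eq_K1_iff)
    have r: "\<theta> (kmul A B) \<otimes> z = ?d \<otimes> z \<or> \<theta> (kmul A B) \<otimes> z = inv (?d \<otimes> z)"
      if z: "z \<in> carrier M" for z
      using rel[OF AB(1,2), of \<one> "twist M e z"] z AB C by (simp add: \<epsilon>_e twist_twist)
    have "\<theta> (kmul A B) \<otimes> x0 \<noteq> ?d \<otimes> x0"
      using ne x0(1) by simp
    then have "inv ?d \<otimes> x0 = inv ?d \<otimes> inv x0"
      using r[of \<one>] r[of x0] ne x0(1) by (simp add: inv_mult)
    then have "inv x0 = x0"
      using x0(1) by simp
    then show False
      using x0 by (simp add: inv_eq_self_iff)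
  qed
  have \<theta>_inv: "inv (\<theta> B) = \<theta> B" for B
  proof (cases "B = K1")
    case False
    obtain A where A: "A \<noteq> K1" "A \<noteq> B"
      using False by (metis klein.distinct(1,3,7))
    have C: "kmul A B \<noteq> K1" "kmul A B \<noteq> A"
      using A False by (cases A; cases B; simp)+
    \<comment> \<open>Writing B as A times AB, and AB as B times A, gives two quotient formulas;
      substituting one into the other cancels \<theta>(A).\<close>
    have "\<theta> B = inv (\<theta> A) \<otimes> \<theta> (kmul A B)"
      using \<theta>_quot[of A "kmul A B"] A C by simp
    also have "\<theta> (kmul A B) = inv (\<theta> B) \<otimes> \<theta> A"
      using \<theta>_quot[of B A] A False by (simp add: kmul_comm)
    also have "inv (\<theta> A) \<otimes> (inv (\<theta> B) \<otimes> \<theta> A) = inv (\<theta> B) \<otimes> (inv (\<theta> A) \<otimes> \<theta> A)"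
      by (simp only: m_lcomm \<theta>_closed inv_closed)
    finally show ?thesis
      by simp
  qed (simp add: \<theta>K1)
  have \<theta>_hom: "\<theta> \<in> hom klein_group M"
  proof (rule homI)
    fix A B
    have "\<theta> A \<otimes> \<theta> A = \<one>" for A
      using \<theta>_inv[of A] by (simp add: inv_eq_self_iff)
    then show "\<theta> (A \<otimes>\<^bsub>klein_group\<^esub> B) = \<theta> A \<otimes> \<theta> B"
      using \<theta>_quot[of A B] by (cases "A = K1 \<or> B = K1 \<or> A = B") (auto simp: \<theta>K1 \<theta>_inv)
  qed simp
  have "\<phi> (A, x) = (f A, twist M (e \<or> A = K1) (g x) \<otimes> \<theta> A)" if "x \<in> carrier M" for A x
  proof (cases "A = K1")
    case True
    then show ?thesis
      using that by (simp add: \<phi>_eq F_eq \<theta>K1 g_def fK1)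
  next
    case False
    then show ?thesis
      using that by (simp add: \<phi>_eq F_eq P_eq \<epsilon>_e m_comm)
  qed
  then show ?thesis
    using f_auto g_auto \<theta>_hom that by blast
qed

end

section \<open>Involutions of the abelian factor\<close>

text \<open>Concatenation of tuples, the second one shifted by \<open>m\<close>. It merges the two
  powers of C_2 that come from the two parameters of \<open>calB\<close>.\<close>

lemma (in group) iso_product_group_split:
  fixes m n :: nat
  shows "product_group {..<m} (\<lambda>_. G) \<times>\<times> product_group {..<n} (\<lambda>_. G) \<cong> product_group {..<m + n} (\<lambda>_. G)"
    (is "?P \<cong> ?Q")
proof -
  let ?h = "\<lambda>(a, b). \<lambda>j\<in>{..<m + n}. if j < m then a j else b (j - m)"
  have "?h \<in> hom ?P ?Q"
    by (rule homI) (auto simp: PiE_iff fun_eq_iff)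
  moreover have "inj_on ?h (carrier ?P)"
  proof (rule inj_onI)
    fix p q
    assume "p \<in> carrier ?P" "q \<in> carrier ?P" and eq: "?h p = ?h q"
    then obtain a b a' b' where pq: "p = (a, b)" "q = (a', b')"
      and a: "a \<in> {..<m} \<rightarrow>\<^sub>E carrier G" "a' \<in> {..<m} \<rightarrow>\<^sub>E carrier G"
      and b: "b \<in> {..<n} \<rightarrow>\<^sub>E carrier G" "b' \<in> {..<n} \<rightarrow>\<^sub>E carrier G"
      by auto
    have "a j = a' j" if "j \<in> {..<m}" for j
      using fun_cong[OF eq, of j] that by (simp add: pq)
    then have "a = a'"
      using a by (meson PiE_ext)
    have "b j = b' j" if "j \<in> {..<n}" for j
      using fun_cong[OF eq, of "m + j"] that by (simp add: pq)
    then have "b = b'"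
      using b by (meson PiE_ext)
    with \<open>a = a'\<close> show "p = q"
      by (simp add: pq)
  qed
  moreover have "?h ` carrier ?P = carrier ?Q"
  proof
    show "?h ` carrier ?P \<subseteq> carrier ?Q"
      by (auto simp: PiE_iff)
    show "carrier ?Q \<subseteq> ?h ` carrier ?P"
    proof
      fix c
      assume c: "c \<in> carrier ?Q"
      then have "c = ?h (\<lambda>j\<in>{..<m}. c j, \<lambda>j\<in>{..<n}. c (m + j))"
        by (auto simp: fun_eq_iff PiE_iff extensional_def)
      moreover have "(\<lambda>j\<in>{..<m}. c j, \<lambda>j\<in>{..<n}. c (m + j)) \<in> carrier ?P"
        using c by (auto simp: PiE_iff)
      ultimately show "c \<in> ?h ` carrier ?P"
        by (rule image_eqI)
    qed
  qed
  ultimately show ?thesis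
    by (intro is_isoI[of ?h]) (simp add: iso_def bij_betw_def)
qed

text \<open>If the order is 2k + 1, then y^(2k+1) = 1, while y^(2k) is already 1.\<close>

lemma (in group) odd_order_imp_no_involution:
  assumes "finite (carrier G)" "odd (order G)" "y \<in> carrier G" "y \<otimes> y = \<one>"
  shows "y = \<one>"
proof -
  obtain k where "order G = 2 * k + 1"
    using assms(2) by (rule oddE)
  then have "y [^] (2 * k + 1) = \<one>"
    using pow_order_eq_1[of y] assms by simp
  moreover have "y [^] (2 * k) = (y [^] (2::nat)) [^] k"
    using assms by (simp add: nat_pow_pow)
  then have "y [^] (2 * k) = \<one>"
    using assms by (simp add: numeral_2_eq_2)
  ultimately show ?thesis
    using assms by simp
qed

lemma (in comm_group) subgroup_Hinv: "subgroup (Hinv G) G"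
proof (rule subgroupI)
  show "inv x \<in> Hinv G" if "x \<in> Hinv G" for x
    using that by (auto simp: Hinv_def simp flip: inv_mult_group)
  show "x \<otimes> y \<in> Hinv G" if "x \<in> Hinv G" "y \<in> Hinv G" for x y
  proof -
    have "(x \<otimes> y) \<otimes> (x \<otimes> y) = (x \<otimes> x) \<otimes> (y \<otimes> y)"
      using that by (simp add: Hinv_def m_ac)
    then show ?thesis
      using that by (simp add: Hinv_def)
  qed
qed (auto simp: Hinv_def)

text \<open>In a cyclic group of order 2i the equation 2z = 0 has exactly the solutions 0 and i, and
  the odd factor has only the trivial one. A 0/1 vector \<epsilon> is therefore sent to the element
  with coordinates \<open>\<epsilon> j * i j\<close> and then carried to M.\<close>

lemma iso_Hinv:
  fixes i :: "nat \<Rightarrow> nat"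
  assumes M: "comm_group M" and i: "\<forall>j<s. i j \<ge> 1"
    and M1: "group M1" "finite (carrier M1)" "odd (order M1)"
    and iso: "M \<cong> product_group {..<s} (\<lambda>j. integer_mod_group (2 * i j)) \<times>\<times> M1"
  shows "product_group {..<s} (\<lambda>_. integer_mod_group 2) \<cong> M\<lparr>carrier := Hinv M\<rparr>"
    (is "?P \<cong> ?H")
proof -
  interpret M: comm_group M by (rule M)
  interpret M1: group M1 by (rule M1(1))
  let ?N = "product_group {..<s} (\<lambda>j. integer_mod_group (2 * i j)) \<times>\<times> M1"
  interpret N: group ?N
    by (intro DirProd_group product_group M1) simp
  obtain h where h: "h \<in> iso ?N M"
    using M.iso_sym[OF iso] by (auto simp: is_iso_def)
  then have h_hom: "h \<in> hom ?N M" and h_inj: "inj_on h (carrier ?N)" and h_surj: "h ` carrier ?N = carrier M"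
    by (auto simp: iso_def bij_betw_def)
  interpret h: group_hom ?N M h
    using h_hom by (simp add: group_hom_def group_hom_axioms_def M.is_group N.is_group)
  let ?t = "\<lambda>\<epsilon>. (\<lambda>j\<in>{..<s}. \<epsilon> j * int (i j), \<one>\<^bsub>M1\<^esub>)"
  have ipos: "0 < int (i j)" if "j < s" for j
    using i that by (simp add: Suc_le_eq)
  have "carrier (integer_mod_group 2) = {0, 1}"
    by (auto simp: carrier_integer_mod_group)
  then have carP: "\<epsilon> \<in> carrier ?P \<longleftrightarrow> \<epsilon> \<in> extensional {..<s} \<and> (\<forall>j<s. \<epsilon> j = 0 \<or> \<epsilon> j = 1)" for \<epsilon>
    by (auto simp: PiE_iff)
  have t_closed: "?t \<epsilon> \<in> carrier ?N" if "\<epsilon> \<in> carrier ?P" for \<epsilon>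
    using that ipos unfolding carP by (fastforce simp: PiE_iff carrier_integer_mod_group)
  have t_mult: "?t (\<epsilon> \<otimes>\<^bsub>?P\<^esub> \<delta>) = ?t \<epsilon> \<otimes>\<^bsub>?N\<^esub> ?t \<delta>" for \<epsilon> \<delta>
  proof -
    \<comment> \<open>Adding multiples of c modulo 2c amounts to adding their coefficients modulo
      2.\<close>
    have "(a + b) mod 2 * c = (a * c + b * c) mod (2 * c)" for a b c :: int
      by (simp add: mult_mod_left distrib_right)
    then show ?thesis
      by (auto simp: fun_eq_iff)
  qed
  have one_iff: "?t \<epsilon> \<otimes>\<^bsub>?N\<^esub> ?t \<epsilon> = \<one>\<^bsub>?N\<^esub>" if "\<epsilon> \<in> carrier ?P" for \<epsilon>
    using that unfolding carP by (auto simp: fun_eq_iff)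
  have w_closed: "h (?t \<epsilon>) \<in> Hinv M" if "\<epsilon> \<in> carrier ?P" for \<epsilon>
    using h.hom_mult[OF t_closed[OF that] t_closed[OF that]] h.hom_closed[OF t_closed[OF that]]
    unfolding one_iff[OF that] h.hom_one by (simp add: Hinv_def)
  let ?w = "\<lambda>\<epsilon>. h (?t \<epsilon>)"
  have "?w \<in> hom ?P ?H"
  proof (rule homI)
    show "?w \<epsilon> \<in> carrier ?H" if "\<epsilon> \<in> carrier ?P" for \<epsilon>
      using w_closed[OF that] by simp
    show "?w (\<epsilon> \<otimes>\<^bsub>?P\<^esub> \<delta>) = ?w \<epsilon> \<otimes>\<^bsub>?H\<^esub> ?w \<delta>" if "\<epsilon> \<in> carrier ?P" "\<delta> \<in> carrier ?P" for \<epsilon> \<delta>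
      unfolding t_mult using h.hom_mult[OF t_closed[OF that(1)] t_closed[OF that(2)]] by simp
  qed
  moreover have "inj_on ?w (carrier ?P)"
  proof (rule inj_onI)
    fix \<epsilon> \<delta>
    assume mem: "\<epsilon> \<in> carrier ?P" "\<delta> \<in> carrier ?P" and eq: "?w \<epsilon> = ?w \<delta>"
    have "?t \<epsilon> = ?t \<delta>"
      using inj_onD[OF h_inj eq] t_closed mem by blast
    then have e: "(\<lambda>j\<in>{..<s}. \<epsilon> j * int (i j)) = (\<lambda>j\<in>{..<s}. \<delta> j * int (i j))"
      by simp
    have "\<epsilon> j = \<delta> j" if "j \<in> {..<s}" for j
      using fun_cong[OF e, of j] ipos[of j] that by simp
    then show "\<epsilon> = \<delta>"
      using mem unfolding carP by (meson extensionalityI)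
  qed
  moreover have "?w ` carrier ?P = carrier ?H"
  proof
    show "?w ` carrier ?P \<subseteq> carrier ?H"
      using w_closed by auto
    show "carrier ?H \<subseteq> ?w ` carrier ?P"
    proof
      fix x
      assume "x \<in> carrier ?H"
      then have x: "x \<in> carrier M" "x \<otimes>\<^bsub>M\<^esub> x = \<one>\<^bsub>M\<^esub>"
        by (auto simp: Hinv_def)
      have "x \<in> h ` carrier ?N"
        using x(1) by (simp only: h_surj)
      then obtain p where p: "p \<in> carrier ?N" "x = h p"
        by blast
      have "h (p \<otimes>\<^bsub>?N\<^esub> p) = h \<one>\<^bsub>?N\<^esub>"
        using h.hom_mult[OF p(1) p(1)] x(2) p(2) h.hom_one by simp
      then have "p \<otimes>\<^bsub>?N\<^esub> p = \<one>\<^bsub>?N\<^esub>"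
        using inj_onD[OF h_inj _ N.m_closed[OF p(1) p(1)] N.one_closed] by blast
      moreover obtain z y where zy: "p = (z, y)"
        by (cases p)
      ultimately have yy: "y \<otimes>\<^bsub>M1\<^esub> y = \<one>\<^bsub>M1\<^esub>"
        and zz: "(\<lambda>j\<in>{..<s}. (z j + z j) mod int (2 * i j)) = (\<lambda>j\<in>{..<s}. 0)"
        by simp_all
      have "y \<in> carrier M1"
        using p(1) zy by simp
      then have y: "y = \<one>\<^bsub>M1\<^esub>"
        using yy by (rule M1.odd_order_imp_no_involution[OF M1(2,3)])
      have z: "z j = 0 \<or> z j = int (i j)" if "j < s" for j
      proof -
        \<comment> \<open>Divisibility of 2z by 2i makes z a multiple of i, and the range 0 to 2i -
          1 leaves the coefficients 0 and 1.\<close>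
        have "(2 * z j) mod (2 * int (i j)) = 0"
          using fun_cong[OF zz, of j] that by simp
        then have "int (i j) dvd z j"
          by auto
        moreover have "z j \<in> carrier (integer_mod_group (2 * i j))"
          using p(1) that by (auto simp: zy PiE_iff)
        then have "0 \<le> z j" "z j < 2 * int (i j)"
          using ipos[OF that] by (auto simp: carrier_integer_mod_group)
        moreover obtain k where k: "z j = int (i j) * k"
          using \<open>int (i j) dvd z j\<close> by (rule dvdE)
        ultimately have "0 \<le> int (i j) * k" "int (i j) * k < int (i j) * 2"
          by (simp_all only: mult.commute[of 2])
        then have "0 \<le> k" "k < 2"
          using ipos[OF that] unfolding mult_less_cancel_left_pos[OF ipos[OF that]]
          by (simp_all add: zero_le_mult_iff)
        then have "k = 0 \<or> k = 1"
          by auto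
        then show ?thesis
          using k by auto
      qed
      define \<epsilon> where "\<epsilon> = (\<lambda>j\<in>{..<s}. if z j = 0 then 0 else 1 :: int)"
      have "\<epsilon> \<in> carrier ?P"
        unfolding carP by (simp add: \<epsilon>_def)
      moreover have "z = (\<lambda>j\<in>{..<s}. \<epsilon> j * int (i j))"
      proof
        fix j
        show "z j = (\<lambda>j\<in>{..<s}. \<epsilon> j * int (i j)) j"
          using p(1) z[of j] by (auto simp: zy \<epsilon>_def PiE_iff extensional_def)
      qed
      then have "x = ?w \<epsilon>"
        using p(2) zy y by simp
      ultimately show "x \<in> ?w ` carrier ?P"
        by blast
    qed
  qed
  ultimately show ?thesis
    by (intro is_isoI[of ?w]) (simp add: iso_def bij_betw_def)
qed

section \<open>Structure of the automorphism and half-automorphism groups\<close>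

lemma (in group_hom) inj_imp_iso_image:
  assumes "inj_on h (carrier G)"
  shows "h \<in> iso G (H\<lparr>carrier := h ` carrier G\<rparr>)"
  using assms by (auto simp: iso_def bij_betw_def hom_def)

section \<open>Homomorphisms from K as pairs of parameters\<close>

context comm_group
begin

text \<open>Commuting elements u and v with trivial squares satisfy the defining relations of
  K.\<close>

lemma alphaK_hom:
  assumes "u \<in> Hinv G" "v \<in> Hinv G"
  shows "alphaK G u v \<in> hom klein_group G"
proof (rule homI)
  have uv: "u \<in> carrier G" "v \<in> carrier G" "u \<otimes> u = \<one>" "v \<otimes> v = \<one>"
    using assms by (auto simp: Hinv_def)
  have c: "u \<otimes> (u \<otimes> v) = v" "v \<otimes> (u \<otimes> v) = u"
    using uv by (metis l_one m_assoc, metis m_lcomm r_one)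
  show "alphaK G u v A \<in> carrier G" for A
    using uv by (cases A) (simp_all add: alphaK_def)
  show "alphaK G u v (A \<otimes>\<^bsub>klein_group\<^esub> B) = alphaK G u v A \<otimes> alphaK G u v B" for A B
    using uv by (cases A; cases B) (simp_all add: alphaK_def m_assoc c m_comm[of v u])
qed

lemma hom_klein_mem_Hinv:
  assumes "\<theta> \<in> hom klein_group G"
  shows "\<theta> A \<in> Hinv G"
proof -
  interpret \<theta>: group_hom klein_group G \<theta>
    using assms by (simp add: group_hom_def group_hom_axioms_def group_klein is_group)
  show ?thesis
    using \<theta>.hom_mult[of A A] \<theta>.hom_closed[of A] \<theta>.hom_one by (simp add: Hinv_def)
qed

text \<open>As c = ab, a homomorphism from K is determined by its values at a and b. Together with
  \<open>alphaK_hom\<close> this identifies pairs in \<open>Hinv G\<close> with homomorphisms from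
  K.\<close>

lemma alphaK_hom_values:
  assumes "\<theta> \<in> hom klein_group G"
  shows "alphaK G (\<theta> Ka) (\<theta> Kb) = \<theta>"
proof
  fix A
  interpret \<theta>: group_hom klein_group G \<theta>
    using assms by (simp add: group_hom_def group_hom_axioms_def group_klein is_group)
  show "alphaK G (\<theta> Ka) (\<theta> Kb) A = \<theta> A"
    using \<theta>.hom_mult[of Ka Kb] \<theta>.hom_one by (cases A) (simp_all add: alphaK_def)
qed

lemma alphaK_one: "alphaK G \<one> \<one> A = \<one>"
  by (cases A) (simp_all add: alphaK_def)

lemma alphaK_mult:
  assumes "u \<in> carrier G" "v \<in> carrier G" "u' \<in> carrier G" "v' \<in> carrier G"
  shows "alphaK G (u \<otimes> u') (v \<otimes> v') A = alphaK G u v A \<otimes> alphaK G u' v' A"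
  using assms by (cases A) (simp_all add: alphaK_def m_ac)

lemma one_mem_Hinv: "\<one> \<in> Hinv G"
  by (simp add: Hinv_def)

end

section \<open>The maps F^+ and the inversion off \<open>K1\<close>\<close>

lemma Fplus_apply:
  "x \<in> carrier M \<Longrightarrow> Fplus M f g u v (A, x) = (f A, g x \<otimes>\<^bsub>M\<^esub> alphaK M u v A)"
  by (simp add: Fplus_def)

lemma Fplus_extensional: "Fplus M f g u v \<in> extensional (UNIV \<times> carrier M)"
  by (simp add: Fplus_def)

lemma (in loop_setup) eq_on_loopL:
  assumes "\<phi> \<in> extensional (UNIV \<times> carrier M)" "\<psi> \<in> extensional (UNIV \<times> carrier M)"
    and "\<And>A x. x \<in> carrier M \<Longrightarrow> \<phi> (A, x) = \<psi> (A, x)"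
  shows "\<phi> = \<psi>"
  using assms by (intro extensionalityI) auto

text \<open>The generator of the factor C_2, restricted to the carrier so that it is an element of
  \<open>Bij\<close>.\<close>

definition flip :: "('a, 'c) monoid_scheme \<Rightarrow> klein \<times> 'a \<Rightarrow> klein \<times> 'a" where
  "flip M = (\<lambda>(A, x) \<in> UNIV \<times> carrier M. (A, twist M (A = K1) x))"

lemma flip_apply: "x \<in> carrier M \<Longrightarrow> flip M (A, x) = (A, twist M (A = K1) x)"
  by (simp add: flip_def)

context loop_setup
begin

text \<open>The case split in the loop product is respected because f A is trivial only for trivial
  A. The inversion commutes with \<open>g\<close> and does not affect the values of
  \<open>alphaK\<close>, which are their own inverses.\<close>

lemma Fplus_auto:
  assumes f: "f \<in> auto klein_group" and g: "g \<in> auto M" and uv: "u \<in> Hinv M" "v \<in> Hinv M"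
  shows "Fplus M f g u v \<in> auto (loopL M)"
proof -
  let ?F = "Fplus M f g u v" and ?\<alpha> = "alphaK M u v"
  have \<alpha>_hom: "?\<alpha> \<in> hom klein_group M"
    using uv by (rule alphaK_hom)
  have \<alpha> [simp]: "?\<alpha> A \<in> carrier M" "?\<alpha> A \<otimes> ?\<alpha> A = \<one>" for A
    using hom_klein_mem_Hinv[OF \<alpha>_hom, of A] by (auto simp: Hinv_def)
  have \<alpha>_inv: "inv (?\<alpha> A) = ?\<alpha> A" for A
    by (simp add: inv_eq_self_iff)
  have \<alpha>_mult: "?\<alpha> (kmul A B) = ?\<alpha> A \<otimes> ?\<alpha> B" for A B
    using hom_mult[OF \<alpha>_hom, of A B] by simp
  have f_bij: "bij f" and fK1: "f K1 = K1"
    using f by (auto simp: auto_klein_iff)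
  have f_mult: "f (kmul A B) = kmul (f A) (f B)" for A B
    using f hom_mult[of f klein_group klein_group A B] by (simp add: auto_def)
  have f_eq: "f A = f B \<longleftrightarrow> A = B" for A B
    using f_bij by (auto simp: bij_def inj_eq)
  have f_eq_K1: "f A = K1 \<longleftrightarrow> A = K1" for A
    using f_eq[of A K1] by (simp add: fK1)
  interpret g: group_hom M M g
    using g by (simp add: group_hom_def group_hom_axioms_def is_group auto_def)
  have g_inj: "g x = g y \<longleftrightarrow> x = y" if "x \<in> carrier M" "y \<in> carrier M" for x y
    using g that by (auto simp: auto_def Bij_def bij_betw_def inj_on_eq_iff)
  have g_twist: "g (twist M e x) = twist M e (g x)" if "x \<in> carrier M" for e x
    using that by (simp add: twist_def)
  have "?F \<in> hom (loopL M) (loopL M)"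
  proof (rule homI)
    show "?F p \<in> carrier (loopL M)" if "p \<in> carrier (loopL M)" for p
      using that by (auto simp: Fplus_apply)
    fix p q
    assume "p \<in> carrier (loopL M)" "q \<in> carrier (loopL M)"
    then obtain A x B y where pq: "p = (A, x)" "q = (B, y)" and x: "x \<in> carrier M" "y \<in> carrier M"
      by auto
    have "twist M (B = K1) (g x \<otimes> ?\<alpha> A) = twist M (B = K1) (g x) \<otimes> ?\<alpha> A"
      using x by (simp add: twist_def inv_mult \<alpha>_inv)
    then show "?F (p \<otimes>\<^bsub>loopL M\<^esub> q) = ?F p \<otimes>\<^bsub>loopL M\<^esub> ?F q"
      using x by (simp add: pq Fplus_apply f_mult f_eq_K1 g_twist \<alpha>_mult m_ac)
  qed
  moreover have "inj_on ?F (UNIV \<times> carrier M)"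
    by (rule inj_onI) (auto simp: Fplus_apply f_eq g_inj)
  then have "bij_betw ?F (UNIV \<times> carrier M) (UNIV \<times> carrier M)"
    unfolding bij_betw_def using fin finite_klein
    by (intro conjI endo_inj_surj finite_cartesian_product) (auto simp: Fplus_apply)
  ultimately show ?thesis
    using Fplus_extensional by (auto simp: auto_def Bij_def)
qed

lemma loopL_closed:
  "\<lbrakk>p \<in> carrier (loopL M); q \<in> carrier (loopL M)\<rbrakk> \<Longrightarrow> p \<otimes>\<^bsub>loopL M\<^esub> q \<in> carrier (loopL M)"
  by auto

lemma subgroup_auto_loopL: "subgroup (auto (loopL M)) (BijGroup (carrier (loopL M)))"
  using loopL_closed by (rule subgroup_auto_closed)

lemma group_AutoGroup_loopL: "group (AutoGroup (loopL M))"
  unfolding AutoGroup_def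
  using subgroup_auto_loopL group_BijGroup by (rule subgroup.subgroup_is_group)

lemma one_AutoGroup_loopL: "\<one>\<^bsub>AutoGroup (loopL M)\<^esub> = (\<lambda>p\<in>UNIV \<times> carrier M. p)"
  by (simp add: AutoGroup_def BijGroup_def)

lemma flip_Bij: "flip M \<in> Bij (UNIV \<times> carrier M)"
proof -
  have "bij_betw (flip M) (UNIV \<times> carrier M) (UNIV \<times> carrier M)"
    by (rule bij_betw_byWitness[where f' = "flip M"]) (auto simp: flip_apply twist_twist)
  then show ?thesis
    by (simp add: Bij_def flip_def)
qed

text \<open>The order is kept when A and B are both trivial, or nontrivial and distinct. It is
  reversed when exactly one of them is trivial or when A = B is nontrivial.\<close>

lemma flip_half:
  assumes "p \<in> UNIV \<times> carrier M" "q \<in> UNIV \<times> carrier M"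
  shows "flip M (p \<otimes>\<^bsub>loopL M\<^esub> q) = flip M p \<otimes>\<^bsub>loopL M\<^esub> flip M q
       \<or> flip M (p \<otimes>\<^bsub>loopL M\<^esub> q) = flip M q \<otimes>\<^bsub>loopL M\<^esub> flip M p"
proof -
  obtain A x B y where pq: "p = (A, x)" "q = (B, y)" and x: "x \<in> carrier M" "y \<in> carrier M"
    using assms by auto
  then show ?thesis
    by (cases "A = K1"; cases "B = K1"; cases "A = B")
      (simp_all add: flip_apply kmul_comm[of B A] kmul_eq_K1_iff twist_def inv_mult m_comm)
qed

text \<open>On the product of (a, 1) and (1, x) the two sides have second components x^-1 and x,
  which differ when x^2 is not 1.\<close>

lemma flip_not_auto: "flip M \<notin> auto (loopL M)"
proof
  obtain x where x: "x \<in> carrier M" "x \<otimes> x \<noteq> \<one>"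
    using ex_square by blast
  assume "flip M \<in> auto (loopL M)"
  then have "flip M ((Ka, \<one>) \<otimes>\<^bsub>loopL M\<^esub> (K1, x)) = flip M (Ka, \<one>) \<otimes>\<^bsub>loopL M\<^esub> flip M (K1, x)"
    using x(1) by (intro hom_mult[of _ "loopL M" "loopL M"]) (auto simp: auto_def)
  then show False
    using x by (simp add: flip_apply twist_def inv_eq_self_iff)
qed

text \<open>The sign + of the classification is F^+ itself and the sign - is F^+ followed by
  \<open>flip\<close>: each \<theta>(A) is its own inverse, so \<open>flip\<close> inverts only the
  factor g x.\<close>

lemma halfauto_cases:
  assumes \<phi>: "\<phi> \<in> halfauto (loopL M)"
  obtains f g u v where "f \<in> auto klein_group" "g \<in> auto M" "u \<in> Hinv M" "v \<in> Hinv M"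
    "\<phi> = Fplus M f g u v \<or> \<phi> = compose (UNIV \<times> carrier M) (flip M) (Fplus M f g u v)"
proof -
  obtain f g \<theta> e where f: "f \<in> auto klein_group" and g: "g \<in> auto M" and \<theta>: "\<theta> \<in> hom klein_group M"
    and eq: "\<And>A x. x \<in> carrier M \<Longrightarrow> \<phi> (A, x) = (f A, twist M (e \<or> A = K1) (g x) \<otimes> \<theta> A)"
    using halfauto_classify[OF \<phi>] by blast
  let ?F = "Fplus M f g (\<theta> Ka) (\<theta> Kb)"
  have \<theta>A: "\<theta> A \<in> carrier M" "inv (\<theta> A) = \<theta> A" for A
    using hom_klein_mem_Hinv[OF \<theta>, of A] by (auto simp: Hinv_def inv_eq_self_iff)
  have F: "?F (A, x) = (f A, g x \<otimes> \<theta> A)" if "x \<in> carrier M" for A x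
    using that by (simp add: Fplus_apply alphaK_hom_values[OF \<theta>])
  have g_closed: "g x \<in> carrier M" if "x \<in> carrier M" for x
    using g that by (auto simp: auto_def hom_def)
  have \<theta>K1: "\<theta> K1 = \<one>"
    using hom_one[OF \<theta> group_klein is_group] by simp
  have "f A = K1 \<longleftrightarrow> A = K1" for A
    using f by (metis auto_klein_iff bij_pointE)
  then have flipF: "flip M (?F (A, x)) = (f A, twist M (A = K1) (g x) \<otimes> \<theta> A)" if "x \<in> carrier M" for A x
    using that g_closed \<theta>A \<theta>K1 by (auto simp: F flip_apply twist_def inv_mult)
  have ext: "\<phi> \<in> extensional (UNIV \<times> carrier M)"
    using \<phi> by (simp add: halfauto_def Bij_def)
  have "\<phi> = ?F \<or> \<phi> = compose (UNIV \<times> carrier M) (flip M) ?F"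
  proof (cases e)
    case True
    then have "\<phi> = ?F"
      using ext Fplus_extensional by (intro eq_on_loopL) (simp_all add: eq F)
    then show ?thesis ..
  next
    case False
    then have "\<phi> = compose (UNIV \<times> carrier M) (flip M) ?F"
      using ext by (intro eq_on_loopL) (simp_all add: eq compose_def flipF)
    then show ?thesis ..
  qed
  then show ?thesis
    using that f g hom_klein_mem_Hinv[OF \<theta>] by blast
qed

section \<open>Automorphisms among the half-automorphisms\<close>

lemma auto_imp_halfauto: "\<phi> \<in> auto (loopL M) \<Longrightarrow> \<phi> \<in> halfauto (loopL M)"
  unfolding auto_def halfauto_def by (blast intro: hom_mult)

lemma mult_BijGroup_loopL:
  assumes "f \<in> Bij (UNIV \<times> carrier M)" "g \<in> Bij (UNIV \<times> carrier M)"
  shows "f \<otimes>\<^bsub>BijGroup (carrier (loopL M))\<^esub> g = compose (UNIV \<times> carrier M) f g"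
  using assms by (simp add: BijGroup_def)

lemma auto_loopL_Bij: "\<phi> \<in> auto (loopL M) \<Longrightarrow> \<phi> \<in> Bij (UNIV \<times> carrier M)"
  by (simp add: auto_def)

text \<open>If an automorphism \<phi> were \<open>flip M\<close> composed with an automorphism F,
  then \<open>flip M\<close> would equal \<phi> F^-1 and be an automorphism itself.\<close>

lemma auto_cases:
  assumes \<phi>: "\<phi> \<in> auto (loopL M)"
  obtains f g u v where "f \<in> auto klein_group" "g \<in> auto M" "u \<in> Hinv M" "v \<in> Hinv M"
    "\<phi> = Fplus M f g u v"
proof -
  let ?B = "BijGroup (carrier (loopL M))"
  interpret B: group ?B
    by (rule group_BijGroup)
  obtain f g u v where fg: "f \<in> auto klein_group" "g \<in> auto M" "u \<in> Hinv M" "v \<in> Hinv M"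
    and cases: "\<phi> = Fplus M f g u v \<or> \<phi> = compose (UNIV \<times> carrier M) (flip M) (Fplus M f g u v)"
    using halfauto_cases[OF auto_imp_halfauto[OF \<phi>]] .
  let ?F = "Fplus M f g u v"
  have F: "?F \<in> auto (loopL M)"
    using fg by (rule Fplus_auto)
  have "\<phi> \<noteq> compose (UNIV \<times> carrier M) (flip M) ?F"
  proof
    assume "\<phi> = compose (UNIV \<times> carrier M) (flip M) ?F"
    then have "\<phi> = flip M \<otimes>\<^bsub>?B\<^esub> ?F"
      using F flip_Bij by (simp only: mult_BijGroup_loopL auto_loopL_Bij)
    moreover have "carrier ?B = Bij (UNIV \<times> carrier M)"
      by (simp add: BijGroup_def)
    ultimately have "flip M = \<phi> \<otimes>\<^bsub>?B\<^esub> inv\<^bsub>?B\<^esub> ?F"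
      using B.inv_solve_right[of "flip M" \<phi> ?F] flip_Bij auto_loopL_Bij[OF F] auto_loopL_Bij[OF \<phi>]
      by metis
    also have "\<dots> \<in> auto (loopL M)"
      by (rule subgroup.m_closed[OF subgroup_auto_loopL \<phi> subgroup.m_inv_closed[OF subgroup_auto_loopL F]])
    finally show False
      using flip_not_auto by simp
  qed
  then show ?thesis
    using cases fg that by blast
qed

text \<open>An automorphism has the form F^+: \<open>f\<close> preserves triviality of the
  K-component, \<open>g\<close> commutes with inversion, and the values of \<open>alphaK\<close> are
  fixed by it.\<close>

lemma flip_comm_auto:
  assumes "\<phi> \<in> auto (loopL M)"
  shows "compose (UNIV \<times> carrier M) (flip M) \<phi> = compose (UNIV \<times> carrier M) \<phi> (flip M)"
proof -
  obtain f g u v where f: "f \<in> auto klein_group" and g: "g \<in> auto M" and uv: "u \<in> Hinv M" "v \<in> Hinv M"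
    and \<phi>: "\<phi> = Fplus M f g u v"
    using auto_cases[OF assms] .
  interpret g: group_hom M M g
    using g by (simp add: group_hom_def group_hom_axioms_def is_group auto_def)
  have \<alpha>: "alphaK M u v A \<in> carrier M" "inv (alphaK M u v A) = alphaK M u v A" for A
    using hom_klein_mem_Hinv[OF alphaK_hom[OF uv], of A] by (auto simp: Hinv_def inv_eq_self_iff)
  have fK: "f A = K1 \<longleftrightarrow> A = K1" for A
    using f by (metis auto_klein_iff bij_pointE)
  show ?thesis
    by (rule eq_on_loopL) (auto simp: compose_def \<phi> Fplus_apply flip_apply fK twist_def inv_mult \<alpha>)
qed

lemma halfauto_loopL:
  "halfauto (loopL M) = auto (loopL M) \<union> (\<lambda>\<phi>. compose (UNIV \<times> carrier M) (flip M) \<phi>) ` auto (loopL M)"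
proof
  show "halfauto (loopL M) \<subseteq> auto (loopL M) \<union> (\<lambda>\<phi>. compose (UNIV \<times> carrier M) (flip M) \<phi>) ` auto (loopL M)"
  proof
    fix \<phi>
    assume "\<phi> \<in> halfauto (loopL M)"
    then obtain f g u v where fg: "f \<in> auto klein_group" "g \<in> auto M" "u \<in> Hinv M" "v \<in> Hinv M"
      and cases: "\<phi> = Fplus M f g u v \<or> \<phi> = compose (UNIV \<times> carrier M) (flip M) (Fplus M f g u v)"
      by (rule halfauto_cases)
    show "\<phi> \<in> auto (loopL M) \<union> (\<lambda>\<phi>. compose (UNIV \<times> carrier M) (flip M) \<phi>) ` auto (loopL M)"
      using cases Fplus_auto[OF fg] by blast
  qed
  have "compose (UNIV \<times> carrier M) (flip M) \<phi> \<in> halfauto (loopL M)" if \<phi>: "\<phi> \<in> auto (loopL M)" for \<phi>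
  proof -
    have "compose (UNIV \<times> carrier M) (flip M) \<phi> \<in> Bij (UNIV \<times> carrier M)"
      using flip_Bij auto_loopL_Bij[OF \<phi>] by (rule compose_Bij)
    moreover have "flip M (\<phi> (p \<otimes>\<^bsub>loopL M\<^esub> q)) = flip M (\<phi> p) \<otimes>\<^bsub>loopL M\<^esub> flip M (\<phi> q)
        \<or> flip M (\<phi> (p \<otimes>\<^bsub>loopL M\<^esub> q)) = flip M (\<phi> q) \<otimes>\<^bsub>loopL M\<^esub> flip M (\<phi> p)"
      if p: "p \<in> UNIV \<times> carrier M" and q: "q \<in> UNIV \<times> carrier M" for p q
    proof -
      have hom: "\<phi> \<in> hom (loopL M) (loopL M)"
        using \<phi> by (simp add: auto_def)
      have "\<phi> p \<in> UNIV \<times> carrier M" "\<phi> q \<in> UNIV \<times> carrier M"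
        using hom_in_carrier[OF hom] p q unfolding carrier_loopL by blast+
      then show ?thesis
        using flip_half[of "\<phi> p" "\<phi> q"] hom_mult[OF hom, of p q] p q unfolding carrier_loopL by simp
    qed
    moreover have "p \<otimes>\<^bsub>loopL M\<^esub> q \<in> UNIV \<times> carrier M"
      if "p \<in> UNIV \<times> carrier M" "q \<in> UNIV \<times> carrier M" for p q
      using loopL_closed that unfolding carrier_loopL by blast
    ultimately show ?thesis
      unfolding halfauto_def carrier_loopL compose_def
      by (intro CollectI conjI ballI) (simp_all only: restrict_apply')
  qed
  then show "auto (loopL M) \<union> (\<lambda>\<phi>. compose (UNIV \<times> carrier M) (flip M) \<phi>) ` auto (loopL M) \<subseteq> halfauto (loopL M)"
    using auto_imp_halfauto by blast
qed

text \<open>Half(L_M) is Aut(L_M) together with its coset by \<open>flip M\<close>, an involution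
  outside Aut(L_M) that commutes with every automorphism.\<close>

lemma iso_HalfGroup:
  "integer_mod_group 2 \<times>\<times> AutoGroup (loopL M) \<cong> HalfGroup (loopL M)"
proof -
  let ?B = "BijGroup (carrier (loopL M))"
  interpret B: group ?B
    by (rule group_BijGroup)
  have car: "carrier ?B = Bij (UNIV \<times> carrier M)"
    by (simp add: BijGroup_def)
  have "flip M \<otimes>\<^bsub>?B\<^esub> flip M = \<one>\<^bsub>?B\<^esub>"
    unfolding mult_BijGroup_loopL[OF flip_Bij flip_Bij]
    by (rule eq_on_loopL) (auto simp: BijGroup_def compose_def flip_apply twist_twist)
  moreover have "flip M \<otimes>\<^bsub>?B\<^esub> \<phi> = \<phi> \<otimes>\<^bsub>?B\<^esub> flip M" if "\<phi> \<in> auto (loopL M)" for \<phi>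
    using that flip_Bij by (simp only: mult_BijGroup_loopL auto_loopL_Bij flip_comm_auto)
  \<comment> \<open>The product of \<open>BijGroup\<close> is \<open>compose\<close> only on
    elements of \<open>Bij\<close>, so the two descriptions of the coset are matched
    elementwise.\<close>
  moreover have "(\<lambda>\<phi>. flip M \<otimes>\<^bsub>?B\<^esub> \<phi>) ` auto (loopL M)
      = (\<lambda>\<phi>. compose (UNIV \<times> carrier M) (flip M) \<phi>) ` auto (loopL M)"
    by (intro image_cong refl mult_BijGroup_loopL flip_Bij auto_loopL_Bij)
  ultimately have "(\<lambda>(n, a). if n = 0 then a else flip M \<otimes>\<^bsub>?B\<^esub> a)
      \<in> iso (integer_mod_group 2 \<times>\<times> ?B\<lparr>carrier := auto (loopL M)\<rparr>) (?B\<lparr>carrier := halfauto (loopL M)\<rparr>)"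
    unfolding halfauto_loopL using B.iso_C2_DirProd[OF subgroup_auto_loopL, of "flip M"] flip_Bij flip_not_auto
    unfolding car by metis
  then show ?thesis
    unfolding HalfGroup_def AutoGroup_def by (rule is_isoI)
qed

section \<open>The subgroups \<open>calA\<close> and \<open>calB\<close>\<close>

lemma calA_group_hom:
  "group_hom (AutoGroup klein_group \<times>\<times> AutoGroup M) (AutoGroup (loopL M)) (\<lambda>(f, g). Fplus M f g \<one> \<one>)"
    (is "group_hom ?P ?L ?h")
proof -
  have "?h \<in> hom ?P ?L"
  proof (rule homI)
    show "?h p \<in> carrier ?L" if "p \<in> carrier ?P" for p
      using that by (auto simp: carrier_AutoGroup Fplus_auto one_mem_Hinv)
    fix p q
    assume "p \<in> carrier ?P" "q \<in> carrier ?P"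
    then obtain f g f' g' where pq: "p = (f, g)" "q = (f', g')"
      and f: "f \<in> auto klein_group" "f' \<in> auto klein_group" and g: "g \<in> auto M" "g' \<in> auto M"
      by (auto simp: carrier_AutoGroup)
    have gc: "g x \<in> carrier M" "g' x \<in> carrier M" if "x \<in> carrier M" for x
      using g that by (auto simp: auto_def hom_def)
    have "Fplus M (compose UNIV f f') (compose (carrier M) g g') \<one> \<one>
        = compose (UNIV \<times> carrier M) (Fplus M f g \<one> \<one>) (Fplus M f' g' \<one> \<one>)"
      by (rule eq_on_loopL) (auto simp: Fplus_extensional compose_def Fplus_apply alphaK_one gc)
    then show "?h (p \<otimes>\<^bsub>?P\<^esub> q) = ?h p \<otimes>\<^bsub>?L\<^esub> ?h q"
      using f g by (simp add: pq mult_AutoGroup Fplus_auto one_mem_Hinv)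
  qed
  then show ?thesis
    by (simp add: group_hom_def group_hom_axioms_def DirProd_group group.AutoGroup group_klein
        is_group group_AutoGroup_loopL)
qed

lemma calA_eq_image:
  "calA M = (\<lambda>(f, g). Fplus M f g \<one> \<one>) ` carrier (AutoGroup klein_group \<times>\<times> AutoGroup M)"
  by (auto simp: calA_def carrier_AutoGroup)

lemma subgroup_calA: "subgroup (calA M) (AutoGroup (loopL M))"
  unfolding calA_eq_image by (rule group_hom.img_is_subgroup[OF calA_group_hom])

text \<open>With trivial parameters F^+ acts componentwise, so \<open>f\<close> can be read off at
  the points (A, 1) and \<open>g\<close> at the points (1, x).\<close>

lemma iso_calA:
  "AutoGroup klein_group \<times>\<times> AutoGroup M \<cong> (AutoGroup (loopL M))\<lparr>carrier := calA M\<rparr>"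
    (is "?P \<cong> _")
proof -
  have "inj_on (\<lambda>(f, g). Fplus M f g \<one> \<one>) (carrier ?P)"
  proof (rule inj_onI, clarsimp simp: carrier_AutoGroup)
    fix f g f' g'
    assume g: "g \<in> auto M" "g' \<in> auto M"
      and eq: "Fplus M f g \<one> \<one> = Fplus M f' g' \<one> \<one>"
    have "f A = f' A" for A
      using fun_cong[OF eq, of "(A, \<one>)"] by (simp add: Fplus_apply)
    moreover have "g = g'"
    proof (rule extensionalityI)
      show "g \<in> extensional (carrier M)" "g' \<in> extensional (carrier M)"
        using g by (auto simp: auto_def Bij_def)
      fix x
      assume x: "x \<in> carrier M"
      then have "g x \<in> carrier M" "g' x \<in> carrier M"
        using g by (auto simp: auto_def hom_def)
      then show "g x = g' x"
        using fun_cong[OF eq, of "(K1, x)"] x by (simp add: Fplus_apply alphaK_one)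
    qed
    ultimately show "f = f' \<and> g = g'"
      by auto
  qed
  then show ?thesis
    unfolding calA_eq_image by (rule is_isoI[OF group_hom.inj_imp_iso_image[OF calA_group_hom]])
qed

text \<open>\<open>calB\<close> is defined with the unrestricted \<open>id\<close>, which need not
  be extensional. Replacing it by the identity restricted to the carrier leaves \<open>Fplus\<close>
  unchanged and gives a member of \<open>auto M\<close>.\<close>

lemma Fplus_id_auto:
  assumes "u \<in> Hinv M" "v \<in> Hinv M"
  shows "Fplus M id id u v \<in> auto (loopL M)"
proof -
  have "Fplus M id id u v = Fplus M id (\<lambda>x\<in>carrier M. x) u v"
    by (rule eq_on_loopL) (simp_all add: Fplus_extensional Fplus_apply)
  moreover have "id \<in> auto klein_group"
    by (simp add: auto_klein_iff)
  ultimately show ?thesis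
    using assms by (simp add: Fplus_auto id_in_auto)
qed

text \<open>Composing two such maps multiplies their \<open>alphaK\<close> factors, and
  \<open>alphaK\<close> is multiplicative in its pair of parameters.\<close>

lemma calB_group_hom:
  "group_hom (M\<lparr>carrier := Hinv M\<rparr> \<times>\<times> M\<lparr>carrier := Hinv M\<rparr>) (AutoGroup (loopL M)) (\<lambda>(u, v). Fplus M id id u v)"
    (is "group_hom ?P ?L ?h")
proof -
  have "?h \<in> hom ?P ?L"
  proof (rule homI)
    show "?h p \<in> carrier ?L" if "p \<in> carrier ?P" for p
      using that by (auto simp: carrier_AutoGroup Fplus_id_auto)
    fix p q
    assume "p \<in> carrier ?P" "q \<in> carrier ?P"
    then obtain u v u' v' where pq: "p = (u, v)" "q = (u', v')"
      and uv: "u \<in> Hinv M" "v \<in> Hinv M" "u' \<in> Hinv M" "v' \<in> Hinv M"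
      by auto
    have uvc: "u \<in> carrier M" "v \<in> carrier M" "u' \<in> carrier M" "v' \<in> carrier M"
      using uv by (auto simp: Hinv_def)
    have \<alpha>: "alphaK M u v A \<in> carrier M" "alphaK M u' v' A \<in> carrier M" for A
      using hom_klein_mem_Hinv[OF alphaK_hom] uv by (auto simp: Hinv_def)
    have "Fplus M id id (u \<otimes> u') (v \<otimes> v')
        = compose (UNIV \<times> carrier M) (Fplus M id id u v) (Fplus M id id u' v')"
      by (rule eq_on_loopL)
        (auto simp: Fplus_extensional compose_def Fplus_apply alphaK_mult uvc \<alpha> m_ac)
    then show "?h (p \<otimes>\<^bsub>?P\<^esub> q) = ?h p \<otimes>\<^bsub>?L\<^esub> ?h q"
      using uv by (simp add: pq mult_AutoGroup Fplus_id_auto)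
  qed
  moreover have "group (M\<lparr>carrier := Hinv M\<rparr>)"
    using subgroup_Hinv is_group by (rule subgroup.subgroup_is_group)
  ultimately show ?thesis
    by (simp add: group_hom_def group_hom_axioms_def DirProd_group group_AutoGroup_loopL)
qed

lemma calB_eq_image:
  "calB M = (\<lambda>(u, v). Fplus M id id u v) ` carrier (M\<lparr>carrier := Hinv M\<rparr> \<times>\<times> M\<lparr>carrier := Hinv M\<rparr>)"
  by (auto simp: calB_def)

lemma subgroup_calB: "subgroup (calB M) (AutoGroup (loopL M))"
  unfolding calB_eq_image by (rule group_hom.img_is_subgroup[OF calB_group_hom])

lemma iso_calB:
  "M\<lparr>carrier := Hinv M\<rparr> \<times>\<times> M\<lparr>carrier := Hinv M\<rparr> \<cong> (AutoGroup (loopL M))\<lparr>carrier := calB M\<rparr>"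
    (is "?P \<cong> _")
proof -
  have "inj_on (\<lambda>(u, v). Fplus M id id u v) (carrier ?P)"
  proof (rule inj_onI, clarsimp)
    fix u v u' v'
    assume uv: "u \<in> Hinv M" "v \<in> Hinv M" "u' \<in> Hinv M" "v' \<in> Hinv M"
      and eq: "Fplus M id id u v = Fplus M id id u' v'"
    show "u = u' \<and> v = v'"
      using fun_cong[OF eq, of "(Ka, \<one>)"] fun_cong[OF eq, of "(Kb, \<one>)"] uv
      by (simp add: Fplus_apply alphaK_def Hinv_def)
  qed
  then show ?thesis
    unfolding calB_eq_image by (rule is_isoI[OF group_hom.inj_imp_iso_image[OF calB_group_hom]])
qed

section \<open>The semidirect decomposition of Aut(L_M)\<close>

lemma inv_klein_hom:
  assumes "f \<in> auto klein_group"
  shows "inv_into UNIV f \<in> hom klein_group klein_group" "inv_into UNIV f (f A) = A" "f (inv_into UNIV f A) = A"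
proof -
  have f: "bij f" "f K1 = K1"
    using assms by (auto simp: auto_klein_iff)
  then show inv: "inv_into UNIV f (f A) = A" "f (inv_into UNIV f A) = A" for A
    by (auto simp: bij_def surj_f_inv_f)
  have "inv_into UNIV f \<in> auto klein_group"
    using f inv[of K1] by (simp add: auto_klein_iff bij_imp_bij_inv)
  then show "inv_into UNIV f \<in> hom klein_group klein_group"
    by (simp add: auto_def)
qed

text \<open>Writing a homomorphism from K in place of (u, v): F(f, g, \<alpha>) is F(id, id,
  \<alpha> f^-1) after F(f, g, 1), and conjugating F(id, id, \<alpha>) by F(f, g, 1) gives F(id, id,
  g \<alpha> f^-1).\<close>

lemma iso_Aut_semidirect:
  defines "L \<equiv> AutoGroup (loopL M)"
  shows "L \<cong> semidirect_product (L\<lparr>carrier := calA M\<rparr>) (L\<lparr>carrier := calB M\<rparr>) (\<lambda>\<alpha> \<beta>. \<alpha> \<otimes>\<^bsub>L\<^esub> \<beta> \<otimes>\<^bsub>L\<^esub> inv\<^bsub>L\<^esub> \<alpha>)"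
proof -
  interpret L: group L
    unfolding L_def by (rule group_AutoGroup_loopL)
  have subs: "subgroup (calA M) L" "subgroup (calB M) L"
    unfolding L_def by (rule subgroup_calA subgroup_calB)+
  have B_hom: "Fplus M id id (\<theta> Ka) (\<theta> Kb) \<in> calB M" if "\<theta> \<in> hom klein_group M" for \<theta>
    unfolding calB_def using hom_klein_mem_Hinv[OF that] by blast
  show ?thesis
  proof (rule L.iso_semidirect_product[OF subs])
    show "calA M \<inter> calB M = {\<one>\<^bsub>L\<^esub>}"
    proof
      show "{\<one>\<^bsub>L\<^esub>} \<subseteq> calA M \<inter> calB M"
        using subs by (simp add: subgroup.one_closed)
      show "calA M \<inter> calB M \<subseteq> {\<one>\<^bsub>L\<^esub>}"
      proof
        fix \<phi>
        assume "\<phi> \<in> calA M \<inter> calB M"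
        then have "\<phi> \<in> calA M" "\<phi> \<in> calB M"
          by auto
        then obtain f g u v where \<phi>: "\<phi> = Fplus M f g \<one> \<one>" "\<phi> = Fplus M id id u v"
          and g: "g \<in> auto M" and uv: "u \<in> Hinv M" "v \<in> Hinv M"
          unfolding calA_def calB_def by blast
        have g1: "g \<one> = \<one>"
          using g hom_one[of g M M] is_group by (auto simp: auto_def)
        have eq: "Fplus M f g \<one> \<one> (A, x) = Fplus M id id u v (A, x)" for A x
          using \<phi> by simp
        \<comment> \<open>At (a, 1) and (b, 1) the second components are 1 for the map in
          \<open>calA\<close>, and u and v for the same map in \<open>calB\<close>.\<close>
        have "u = \<one>" "v = \<one>"
          using eq[of Ka \<one>] eq[of Kb \<one>] uv by (simp_all add: Fplus_apply alphaK_def g1 Hinv_def)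
        then have "\<phi> = (\<lambda>p\<in>UNIV \<times> carrier M. p)"
          unfolding \<phi>(2) by (intro eq_on_loopL) (simp_all add: Fplus_extensional Fplus_apply alphaK_one)
        then show "\<phi> \<in> {\<one>\<^bsub>L\<^esub>}"
          by (simp add: L_def one_AutoGroup_loopL)
      qed
    qed
  next
    fix \<phi>
    assume "\<phi> \<in> carrier L"
    then have "\<phi> \<in> auto (loopL M)"
      by (simp add: L_def carrier_AutoGroup)
    then obtain f g u v where f: "f \<in> auto klein_group" and g: "g \<in> auto M"
      and uv: "u \<in> Hinv M" "v \<in> Hinv M" and \<phi>: "\<phi> = Fplus M f g u v"
      by (rule auto_cases)
    \<comment> \<open>The factor from \<open>calA\<close> is applied first, so the factor from
      \<open>calB\<close> sees f A and has to undo \<open>f\<close> before applying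
      \<open>alphaK\<close>.\<close>
    define \<theta> where "\<theta> = alphaK M u v \<circ> inv_into UNIV f"
    have \<theta>: "\<theta> \<in> hom klein_group M"
      unfolding \<theta>_def using inv_klein_hom(1)[OF f] alphaK_hom[OF uv] by (rule Group.hom_compose)
    let ?a = "Fplus M f g \<one> \<one>" and ?b = "Fplus M id id (\<theta> Ka) (\<theta> Kb)"
    have a: "?a \<in> calA M"
      using f g by (auto simp: calA_def)
    have b: "?b \<in> calB M"
      using \<theta> by (rule B_hom)
    have gc: "g x \<in> carrier M" if "x \<in> carrier M" for x
      using g that by (auto simp: auto_def hom_def)
    have "\<phi> = compose (UNIV \<times> carrier M) ?b ?a"
      unfolding \<phi>
      by (rule eq_on_loopL) (simp_all add: Fplus_extensional compose_def Fplus_apply gc alphaK_one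
          alphaK_hom_values[OF \<theta>], simp add: \<theta>_def inv_klein_hom(2)[OF f])
    also have "\<dots> = ?b \<otimes>\<^bsub>L\<^esub> ?a"
      using subs a b unfolding L_def
      by (simp add: mult_AutoGroup subgroup.mem_carrier carrier_AutoGroup[symmetric])
    finally show "\<exists>a\<in>calA M. \<exists>b\<in>calB M. \<phi> = b \<otimes>\<^bsub>L\<^esub> a"
      using a b by blast
  next
    fix a b
    assume a: "a \<in> calA M" and b: "b \<in> calB M"
    from a obtain f g where f: "f \<in> auto klein_group" and g: "g \<in> auto M" and a_eq: "a = Fplus M f g \<one> \<one>"
      by (auto simp: calA_def)
    from b obtain u v where uv: "u \<in> Hinv M" "v \<in> Hinv M" and b_eq: "b = Fplus M id id u v"
      by (auto simp: calB_def)
    interpret g: group_hom M M g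
      using g by (simp add: group_hom_def group_hom_axioms_def is_group auto_def)
    \<comment> \<open>Comparing second components of a b and b' a at (A, x), namely g(x \<alpha>(A))
      and g(x) \<theta>(f A), dictates this choice.\<close>
    define \<theta> where "\<theta> = (g \<circ> alphaK M u v) \<circ> inv_into UNIV f"
    have \<theta>: "\<theta> \<in> hom klein_group M"
      unfolding \<theta>_def
      using inv_klein_hom(1)[OF f] Group.hom_compose[OF alphaK_hom[OF uv] g.homh] by (rule Group.hom_compose)
    let ?b = "Fplus M id id (\<theta> Ka) (\<theta> Kb)"
    have b': "?b \<in> calB M"
      using \<theta> by (rule B_hom)
    have \<alpha>: "alphaK M u v A \<in> carrier M" for A
      using hom_klein_mem_Hinv[OF alphaK_hom[OF uv]] by (auto simp: Hinv_def)
    have mem: "a \<in> carrier L" "b \<in> carrier L" "?b \<in> carrier L"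
      using subs a b b' by (auto simp: subgroup.mem_carrier)
    have "compose (UNIV \<times> carrier M) a b = compose (UNIV \<times> carrier M) ?b a"
      unfolding a_eq b_eq
      by (rule eq_on_loopL) (simp_all add: compose_def Fplus_apply alphaK_one \<alpha>
          alphaK_hom_values[OF \<theta>], simp add: \<theta>_def inv_klein_hom(2)[OF f])
    then have "a \<otimes>\<^bsub>L\<^esub> b = ?b \<otimes>\<^bsub>L\<^esub> a"
      using mem unfolding L_def by (simp add: mult_AutoGroup carrier_AutoGroup)
    then have "a \<otimes>\<^bsub>L\<^esub> b \<otimes>\<^bsub>L\<^esub> inv\<^bsub>L\<^esub> a = ?b"
      using mem by (simp add: L.m_assoc)
    then show "a \<otimes>\<^bsub>L\<^esub> b \<otimes>\<^bsub>L\<^esub> inv\<^bsub>L\<^esub> a \<in> calB M"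
      using b' by simp
  qed
qed

end

theorem theorem5p9:
  fixes M :: "('a, 'c) monoid_scheme" and M1 :: "('b, 'd) monoid_scheme"
    and s :: nat and i :: "nat \<Rightarrow> nat"
  assumes "comm_group M" and "finite (carrier M)"
    and "group_exponent M > 2" and "even (order M)"
    and "s \<ge> 1" and "\<forall>j<s. i j \<ge> 1"
    and "group M1" and "finite (carrier M1)" and "odd (order M1)"
    and "M \<cong> product_group {..<s} (\<lambda>j. integer_mod_group (2 * i j)) \<times>\<times> M1"
  shows "let AutL = AutoGroup (loopL M);
             Agrp = AutL\<lparr>carrier := calA M\<rparr>;
             Bgrp = AutL\<lparr>carrier := calB M\<rparr>;
             \<sigma> = (\<lambda>\<alpha> \<beta>. \<alpha> \<otimes>\<^bsub>AutL\<^esub> \<beta> \<otimes>\<^bsub>AutL\<^esub> inv\<^bsub>AutL\<^esub> \<alpha>)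
         in AutL \<cong> semidirect_product Agrp Bgrp \<sigma>
          \<and> HalfGroup (loopL M) \<cong> integer_mod_group 2 \<times>\<times> semidirect_product Agrp Bgrp \<sigma>
          \<and> Agrp \<cong> sym_group 3 \<times>\<times> AutoGroup M
          \<and> Bgrp \<cong> product_group {..<2 * s} (\<lambda>_. integer_mod_group 2)"
proof -
  interpret M: comm_group M by (rule assms(1))
  have "\<exists>x\<in>carrier M. x \<otimes>\<^bsub>M\<^esub> x \<noteq> \<one>\<^bsub>M\<^esub>"
  proof (rule ccontr)
    assume "\<not> ?thesis"
    \<comment> \<open>If all squares were trivial, 2 would be a candidate for the least
      exponent.\<close>
    then have "group_exponent M \<le> 2"
      unfolding group_exponent_def by (intro Least_le) (simp add: numeral_2_eq_2)
    then show False
      using assms(3) by simp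
  qed
  then interpret loop_setup M
    using assms(2) by unfold_locales
  let ?L = "AutoGroup (loopL M)" and ?C2 = "integer_mod_group 2"
  let ?A = "?L\<lparr>carrier := calA M\<rparr>" and ?B = "?L\<lparr>carrier := calB M\<rparr>"
  let ?S = "semidirect_product ?A ?B (\<lambda>\<alpha> \<beta>. \<alpha> \<otimes>\<^bsub>?L\<^esub> \<beta> \<otimes>\<^bsub>?L\<^esub> inv\<^bsub>?L\<^esub> \<alpha>)"
  have 1: "?L \<cong> ?S"
    by (rule iso_Aut_semidirect)
  have "HalfGroup (loopL M) \<cong> ?C2 \<times>\<times> ?L"
    by (intro group.iso_sym[OF _ iso_HalfGroup] DirProd_group group_integer_mod_group group_AutoGroup_loopL)
  also have "?C2 \<times>\<times> ?L \<cong> ?C2 \<times>\<times> ?S"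
    using 1 by (intro group.DirProd_iso_trans group_integer_mod_group iso_refl)
  finally have 2: "HalfGroup (loopL M) \<cong> ?C2 \<times>\<times> ?S" .
  have K: "group (AutoGroup klein_group)" and AM: "group (AutoGroup M)"
    by (simp_all add: group.AutoGroup group_klein M.AutoGroup)
  have "?A \<cong> AutoGroup klein_group \<times>\<times> AutoGroup M"
    using K AM by (intro group.iso_sym[OF _ iso_calA] DirProd_group)
  also have "\<dots> \<cong> sym_group 3 \<times>\<times> AutoGroup M"
    using K by (intro group.DirProd_iso_trans group.iso_sym[OF sym_group_is_group auto_klein_iso_sym_group] iso_refl)
  finally have 3: "?A \<cong> sym_group 3 \<times>\<times> AutoGroup M" .
  let ?H = "M\<lparr>carrier := Hinv M\<rparr>" and ?P = "product_group {..<s} (\<lambda>_. ?C2)"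
  have H: "group ?H"
    using M.subgroup_Hinv M.is_group by (rule subgroup.subgroup_is_group)
  have "?P \<cong> ?H"
    using iso_Hinv[OF assms(1,6,7,8,9,10)] .
  then have HP: "?H \<cong> ?P"
    by (rule group.iso_sym[rotated]) simp
  \<comment> \<open>Each of the two parameters ranges over the involution group of M, a copy of
    C_2^s, which accounts for the exponent 2s.\<close>
  have "?B \<cong> ?H \<times>\<times> ?H"
    using H by (intro group.iso_sym[OF _ iso_calB] DirProd_group)
  also have "\<dots> \<cong> ?P \<times>\<times> ?P"
    using H HP by (intro group.DirProd_iso_trans)
  also have "\<dots> \<cong> product_group {..<s + s} (\<lambda>_. ?C2)"
    by (intro group.iso_product_group_split) simp
  finally have 4: "?B \<cong> product_group {..<2 * s} (\<lambda>_. ?C2)"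
    by (simp add: mult_2)
  show ?thesis
    unfolding Let_def using 1 2 3 4 by blast
qed

end
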